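(* Let $\tilde m>0$ and $a\in\mathbb{R}\setminus\{0\}$, and let $V_0,V_1:\mathbb{R}\to\mathbb{R}$ be smooth, compactly supported functions with $\|V_0\|_{L^\infty}+\tfrac12\|V_1\|_{L^1}<\tilde m/|a|$. Let $z$, $U$ (with dynamical momentum $p^1$), with $U$ Lipschitz continuous on $\mathbb{R}_{\ge0}\times\mathbb{R}$ and $z$ a Lipschitz continuous world-line, satisfy the joint initial value problem $$\left\{\begin{array}{rcl}\eta^{\mu\nu}\partial_\mu\partial_\nu U(x)&=&a\int\delta^{(2)}(x-z(\tau))\,d\tau,\\ U(0,x^1)&=&-\frac a2|x^1|+V_0(x^1),\\ \partial_0U(0,x^1)&=&V_1(x^1),\end{array}\right.$$ $$\frac{dz^1}{dx^0}=\frac{p^1}{\sqrt{m^2+(p^1)^2}},\qquad \frac{dp^1}{dx^0}=-\frac{a^2}{2}\frac{p^1}{\sqrt{m^2+(p^1)^2}}+a\frac{m}{\sqrt{m^2+(p^1)^2}}\,\partial_1V(x^0,z^1),\qquad z^1(0)=0,\ p^1(0)=0,$$ where $m=m(x^0)=\tilde m-aU(x^0,z^1(x^0))$. Then for every $\epsilon>0$ there exists $T_\epsilon>0$ such that $|u^1(x^0)|<\epsilon$ for all $x^0>T_\epsilon$, where $u^1=dz^1/d\tau=p^1/m$.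
   Context: Space-time has coordinates $(x^0,x^1)$ and metric $\eta_{\mu\nu}=\mathrm{diag}(1,-1)$, so $\eta^{\mu\nu}\partial_\mu\partial_\nu=\partial_0^2-\partial_1^2$. The particle has world-line $z=(x^0,z^1(x^0))$, $x^0\ge0$, proper time $\tau$ with $d\tau=\sqrt{1-(dz^1/dx^0)^2}\,dx^0$, bare mass $\tilde m$, scalar charge $a$, and dynamical momentum $p^1$. The function $V$ is the solution of the free wave equation $\eta^{\mu\nu}\partial_\mu\partial_\nu V=0$, $V(0,x^1)=V_0(x^1)$, $\partial_0V(0,x^1)=V_1(x^1)$. The Cauchy problem for $U$ with given $z$ is understood in the distributional sense. Its solution is $U=V+U_{\rm stat}+U_{\rm source}$, where $U_{\rm stat}$ solves the free wave equation with data $U_{\rm stat}(0,x^1)=-\frac a2|x^1|$, $\partial_0U_{\rm stat}(0,x^1)=0$, and $U_{\rm source}$ solves the sourced equation $\eta^{\mu\nu}\partial_\mu\partial_\nu U_{\rm source}=a\int\delta^{(2)}(x-z(\tau))d\tau$ with zero data. By Duhamel's principle, $$U_{\rm source}(x^0,x^1)=\frac a2\int_0^{x^0}\sqrt{1-\left(\tfrac{dz^1}{dx^0}(t)\right)^2}\ \chi_{[x^1-(x^0-t),\,x^1+(x^0-t)]}(z^1(t))\,dt,$$ where $\chi_I$ is the indicator function of $I$. The ordinary differential equations for $(z^1,p^1)$ are equivalently understood in integrated form. *)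

theory Defs
  imports "HOL-Analysis.Analysis" "HOL-Probability.Essential_Supremum"
begin

section \<open>Smooth and compactly supported functions\<close>

definition partial :: "'a::euclidean_space \<Rightarrow> ('a \<Rightarrow> real) \<Rightarrow> 'a \<Rightarrow> real" where
  "partial b f x = frechet_derivative f (at x) b"

fun C_k :: "nat \<Rightarrow> ('a::euclidean_space \<Rightarrow> real) \<Rightarrow> bool" where
  "C_k 0 f \<longleftrightarrow> continuous_on UNIV f"
| "C_k (Suc k) f \<longleftrightarrow> f differentiable_on UNIV \<and> (\<forall>b\<in>Basis. C_k k (partial b f))"

definition smooth :: "('a::euclidean_space \<Rightarrow> real) \<Rightarrow> bool" where
  "smooth f \<longleftrightarrow> (\<forall>k. C_k k f)"

definition compact_support :: "('a::euclidean_space \<Rightarrow> real) \<Rightarrow> bool" where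
  "compact_support f \<longleftrightarrow> compact (closure (support_on UNIV f))"

section \<open>The wave equation on 1+1-dimensional space-time\<close>

text \<open>Space-time points are pairs \<open>(x\<^sup>0, x\<^sup>1)\<close>; the metric is \<open>diag (1, -1)\<close>.\<close>

abbreviation d0 :: "(real \<times> real \<Rightarrow> real) \<Rightarrow> real \<times> real \<Rightarrow> real" where
  "d0 \<equiv> partial (1, 0)"

abbreviation d1 :: "(real \<times> real \<Rightarrow> real) \<Rightarrow> real \<times> real \<Rightarrow> real" where
  "d1 \<equiv> partial (0, 1)"

definition dalembertian :: "(real \<times> real \<Rightarrow> real) \<Rightarrow> real \<times> real \<Rightarrow> real" where
  "dalembertian f x = d0 (d0 f) x - d1 (d1 f) x"

definition free_wave_solution ::
  "(real \<Rightarrow> real) \<Rightarrow> (real \<Rightarrow> real) \<Rightarrow> (real \<times> real \<Rightarrow> real) \<Rightarrow> bool" where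
  "free_wave_solution V0 V1 V \<longleftrightarrow>
     C_k 2 V \<and> (\<forall>x. dalembertian V x = 0) \<and>
     (\<forall>y. V (0, y) = V0 y) \<and> (\<forall>y. d0 V (0, y) = V1 y)"

definition test_function :: "(real \<times> real \<Rightarrow> real) \<Rightarrow> bool" where
  "test_function \<phi> \<longleftrightarrow> smooth \<phi> \<and> compact_support \<phi>"

text \<open>
  Distributional solutions of the Cauchy problem on \<open>x\<^sup>0 \<ge> 0\<close> with source \<open>F\<close>, given as a functional
  on test functions, and data \<open>U0\<close>, \<open>U1\<close>. The test functions need not vanish near \<open>x\<^sup>0 = 0\<close>:
  the boundary terms from integrating \<open>\<phi> \<partial>\<^sub>0\<partial>\<^sub>0U\<close> by parts twice over \<open>x\<^sup>0 \<ge> 0\<close> carry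
  the initial data, in particular the initial value of \<open>\<partial>\<^sub>0U\<close>, which need not exist pointwise.
\<close>

definition distributional_wave_solution ::
  "((real \<times> real \<Rightarrow> real) \<Rightarrow> real) \<Rightarrow> (real \<Rightarrow> real) \<Rightarrow> (real \<Rightarrow> real) \<Rightarrow>
   (real \<times> real \<Rightarrow> real) \<Rightarrow> bool" where
  "distributional_wave_solution F U0 U1 U \<longleftrightarrow>
     (\<forall>y. U (0, y) = U0 y) \<and>
     (\<forall>\<phi>. test_function \<phi> \<longrightarrow>
        (LINT x:{0..} \<times> UNIV|lborel. U x * dalembertian \<phi> x) =
          F \<phi> + (LINT y|lborel. U1 y * \<phi> (0, y)) - (LINT y|lborel. U0 y * d0 \<phi> (0, y)))"

section \<open>The particle\<close>

text \<open>A world-line \<open>(x\<^sup>0, z\<^sup>1(x\<^sup>0))\<close>, \<open>x\<^sup>0 \<ge> 0\<close>, is given by \<open>z\<^sup>1\<close>; values at negative times play no role.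
  The function below is \<open>d\<tau>/dx\<^sup>0\<close>.\<close>

definition proper_time_rate :: "(real \<Rightarrow> real) \<Rightarrow> real \<Rightarrow> real" where
  "proper_time_rate z t = sqrt (1 - (deriv z t)\<^sup>2)"

text \<open>\<open>dz\<^sup>1/d\<tau>\<close>, by the chain rule.\<close>

definition proper_velocity :: "(real \<Rightarrow> real) \<Rightarrow> real \<Rightarrow> real" where
  "proper_velocity z t = deriv z t / proper_time_rate z t"

text \<open>The distribution \<open>a \<integral> \<delta>\<^sup>2(x - z(\<tau>)) d\<tau>\<close>, with the integral parametrised by \<open>x\<^sup>0\<close>.\<close>

definition point_source :: "real \<Rightarrow> (real \<Rightarrow> real) \<Rightarrow> (real \<times> real \<Rightarrow> real) \<Rightarrow> real" where
  "point_source a z \<phi> = a * (LINT t:{0..}|lborel. \<phi> (t, z t) * proper_time_rate z t)"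

definition dynamical_mass ::
  "real \<Rightarrow> real \<Rightarrow> (real \<times> real \<Rightarrow> real) \<Rightarrow> (real \<Rightarrow> real) \<Rightarrow> real \<Rightarrow> real" where
  "dynamical_mass mt a U z t = mt - a * U (t, z t)"

text \<open>The equations of motion in integrated form, with their initial values; \<open>m\<close> is the
  time-dependent mass.\<close>

definition equations_of_motion ::
  "real \<Rightarrow> (real \<times> real \<Rightarrow> real) \<Rightarrow> (real \<Rightarrow> real) \<Rightarrow> (real \<Rightarrow> real) \<Rightarrow> (real \<Rightarrow> real) \<Rightarrow> bool" where
  "equations_of_motion a V m z p \<longleftrightarrow>
     z 0 = 0 \<and> p 0 = 0 \<and>
     (\<forall>t\<ge>0. ((\<lambda>s. p s / sqrt ((m s)\<^sup>2 + (p s)\<^sup>2)) has_integral (z t - z 0)) {0..t}) \<and>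
     (\<forall>t\<ge>0. ((\<lambda>s. - (a\<^sup>2 / 2) * (p s / sqrt ((m s)\<^sup>2 + (p s)\<^sup>2))
                 + a * (m s / sqrt ((m s)\<^sup>2 + (p s)\<^sup>2)) * d1 V (s, z s))
              has_integral (p t - p 0)) {0..t})"

end

theory Submission
  imports Defs
begin

text \<open>Testing the wave equation with products of plateau functions of the null coordinates
  \<open>t + x\<close> and \<open>t - x\<close> yields d'Alembert's formula for \<open>U\<close>. On the world-line all past source points
  lie in the backward light cone, so the dynamical mass is
  \<open>m = mt - a V + (a\<^sup>2/2) \<integral> (1 - d\<tau>/dx\<^sup>0)\<close>. The smallness of the data keeps \<open>mt - a V\<close> above some
  \<open>\<delta> > 0\<close>, and a continuation argument shows \<open>m \<ge> \<delta>\<close> for all times; also \<open>m\<close> grows at most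
  linearly. The term \<open>-(a\<^sup>2/2) dz/dx\<^sup>0\<close> acts as friction: it prevents the particle from travelling
  with \<open>V\<close> forever, and once \<open>V\<close> exerts no force any more, \<open>p' = -(a\<^sup>2/2) p / sqrt (m\<^sup>2 + p\<^sup>2)\<close> with
  linearly bounded \<open>m\<close> makes \<open>p\<^sup>2\<close> decay at least like \<open>1/t\<close>.\<close>

section \<open>Smooth functions with prescribed support\<close>

text \<open>The difficulty is a circle: \<open>m\<close> is read off from \<open>U\<close> on the
  world-line, \<open>U\<close> depends on the elapsed proper time, and the proper-time rate is |m| /
  E, which is \<open>m / E\<close> only where \<open>m\<close> is positive. So the formula for
  \<open>m\<close> is available only as long as positivity is known. The circle closes because
  proper time never runs faster than coordinate time: the integral term is nonnegative, and
  \<open>m\<close> stays above mt - |a| M, where M < mt / |a| bounds |V|.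

  The static data make - a U grow like (a^2/2) t on the world-line, and the source takes back
  (a^2/2) times the elapsed proper time; this is the origin of the factor 1 - d\<tau>/dx^0.

  The force \<open>d1 V\<close> is a sum of a function of t + x and a function of t - x, both
  vanishing for large arguments. Both null coordinates are nondecreasing along a causal world-line,
  so it is enough that each of them exceeds a given R at one single time. Finally u = p / m, and
  \<open>m\<close> is bounded below, so decay of \<open>p\<close> suffices.\<close>

lemma partial_eq:
  assumes "(f has_derivative f') (at x)"
  shows "partial b f x = f' b"
  using frechet_derivative_at[OF assms] by (simp add: partial_def)

lemma partial_real_eq:
  assumes "(f has_real_derivative f') (at x)"
  shows "partial 1 f x = f'"
  using partial_eq[of f "(*) f'" x 1] assms by (simp add: has_field_derivative_def)

lemma C_k_Suc_has_derivative:
  assumes "C_k (Suc k) f"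
  shows "(f has_derivative frechet_derivative f (at x)) (at x)"
  using assms by (simp add: frechet_derivative_works[symmetric] differentiable_on_def)

lemma C_k_Suc_has_real_derivative:
  fixes f :: "real \<Rightarrow> real"
  assumes "C_k (Suc k) f"
  shows "(f has_real_derivative partial 1 f x) (at x)"
proof -
  have d: "(f has_derivative frechet_derivative f (at x)) (at x)"
    by (rule C_k_Suc_has_derivative[OF assms])
  have "frechet_derivative f (at x) h = partial 1 f x * h" for h
    using linear_scale[OF has_derivative_linear[OF d], of h 1]
    by (simp add: partial_def)
  then have "frechet_derivative f (at x) = (*) (partial 1 f x)" by blast
  with d show ?thesis by (simp add: has_field_derivative_def)
qed

lemma C_k_SucD: "C_k (Suc k) f \<Longrightarrow> C_k k f"
proof (induction k arbitrary: f)
  case 0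
  then show ?case by (auto intro: differentiable_imp_continuous_on)
qed auto

lemma C_k_SucI:
  assumes "\<And>x. (f has_derivative f' x) (at x)" and "\<And>b. b \<in> Basis \<Longrightarrow> C_k k (\<lambda>x. f' x b)"
  shows "C_k (Suc k) f"
proof -
  have "partial b f = (\<lambda>x. f' x b)" for b
    using partial_eq[OF assms(1)] by auto
  then show ?thesis
    using assms by (auto simp: differentiable_on_def differentiable_def)
qed

lemma C_k_SucI_real:
  assumes "\<And>x. (f has_real_derivative f' x) (at x)" and "C_k k f'"
  shows "C_k (Suc k) f"
  by (rule C_k_SucI[where f' = "\<lambda>x. (*) (f' x)"])
    (use assms in \<open>auto simp: has_field_derivative_def\<close>)

lemma C_k_const: "C_k k (\<lambda>x. c)"
proof (induction k arbitrary: c)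
  case (Suc k)
  show ?case by (rule C_k_SucI[where f' = "\<lambda>x h. 0"]) (auto simp: Suc)
qed (auto intro: continuous_intros)

lemma C_k_add: "C_k k f \<Longrightarrow> C_k k g \<Longrightarrow> C_k k (\<lambda>x. f x + g x)"
proof (induction k arbitrary: f g)
  case (Suc k)
  note d = has_derivative_add[OF C_k_Suc_has_derivative[OF Suc.prems(1)]
      C_k_Suc_has_derivative[OF Suc.prems(2)]]
  show ?case
    by (rule C_k_SucI[OF d], fold partial_def) (use Suc in simp)
qed (auto intro: continuous_intros)

lemma C_k_mult: "C_k k f \<Longrightarrow> C_k k g \<Longrightarrow> C_k k (\<lambda>x. f x * g x)"
proof (induction k arbitrary: f g)
  case (Suc k)
  note d = has_derivative_mult[OF C_k_Suc_has_derivative[OF Suc.prems(1)]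
      C_k_Suc_has_derivative[OF Suc.prems(2)]]
  have "C_k k f" "C_k k g" using Suc.prems C_k_SucD by auto
  then show ?case
    by (intro C_k_SucI[OF d], fold partial_def) (intro C_k_add Suc.IH; use Suc.prems in simp)
qed (auto intro: continuous_intros)

text \<open>The derivative \<open>l\<close> of the inner map is constant, so differentiation only
  adds the constant factor \<open>l h\<close> and the induction closes without a general chain rule
  for \<open>C_k\<close>. Shifts, rescalings and null coordinates all have this form.\<close>

lemma C_k_compose_affine:
  fixes f :: "real \<Rightarrow> real"
  assumes "bounded_linear l" and "C_k k f"
  shows "C_k k (\<lambda>x. f (l x + c))"
  using assms(2)
proof (induction k arbitrary: f)
  case 0
  have "continuous_on UNIV (\<lambda>x. l x + c)"
    by (intro continuous_intros linear_continuous_on assms)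
  then show ?case using 0 by (auto intro: continuous_on_compose2)
next
  case (Suc k)
  have l: "((\<lambda>x. l x + c) has_derivative l) (at x)" for x
    by (auto intro!: derivative_eq_intros bounded_linear_imp_has_derivative assms)
  have d: "((\<lambda>x. f (l x + c)) has_derivative (\<lambda>h. partial 1 f (l x + c) * l h)) (at x)" for x
    using has_derivative_compose[OF l,
        of f "(*) (partial 1 f (l x + c))"]
      C_k_Suc_has_real_derivative[OF Suc.prems] by (simp add: has_field_derivative_def)
  show ?case
    by (rule C_k_SucI[OF d]) (intro C_k_mult C_k_const Suc.IH; use Suc.prems in simp)
qed

text \<open>The family P(1/x) exp(-1/x), extended by 0, is closed under differentiation, unlike the
  single function exp(-1/x); so one induction over \<open>k\<close>, for all \<open>P\<close> at
  once, gives smoothness.\<close>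

definition flat :: "real poly \<Rightarrow> real \<Rightarrow> real" where
  "flat P x = (if x > 0 then poly P (1 / x) * exp (- (1 / x)) else 0)"

lemma poly_times_exp_minus_tendsto_0:
  "((\<lambda>y. poly P y * exp (- y)) \<longlongrightarrow> (0::real)) at_top"
proof -
  have "(\<lambda>y. poly P y * exp (- y)) = (\<lambda>y. \<Sum>i\<le>degree P. coeff P i * (y ^ i / exp y))"
    by (simp add: poly_altdef exp_minus sum_distrib_right divide_inverse mult.assoc)
  moreover have "((\<lambda>y. \<Sum>i\<le>degree P. coeff P i * (y ^ i / exp y)) \<longlongrightarrow> 0) at_top"
    by (intro tendsto_null_sum tendsto_mult_right_zero tendsto_power_div_exp_0)
  ultimately show ?thesis by simp
qed

text \<open>With y = 1/x one has dy/dx = - y^2, and P(y) exp(-y) has the y-derivative (P' - P)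
  exp(-y); this gives the factor y^2 (P - P'). Only the origin needs a limit.\<close>

lemma flat_has_derivative:
  "(flat P has_real_derivative flat ([:0, 0, 1:] * (P - pderiv P)) x) (at x)"
proof (cases "x = 0")
  case False
  show ?thesis
  proof (cases "x > 0")
    case True
    have "((\<lambda>x. poly P (1 / x) * exp (- (1 / x))) has_real_derivative
            flat ([:0, 0, 1:] * (P - pderiv P)) x) (at x)"
      using True
      by (auto intro!: derivative_eq_intros simp: flat_def field_simps power2_eq_square)
    moreover have "\<forall>\<^sub>F y in nhds x. flat P y = poly P (1 / y) * exp (- (1 / y))"
      using eventually_nhds_in_open[of "{0<..}" x] True
      by (auto elim!: eventually_mono simp: flat_def)
    ultimately show ?thesis by (subst DERIV_cong_ev[OF refl _ refl])
  next
    case neg: False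
    have "\<forall>\<^sub>F y in nhds x. flat P y = 0"
      using eventually_nhds_in_open[of "{..<0}" x] neg False
      by (auto elim!: eventually_mono simp: flat_def)
    moreover have "((\<lambda>x. 0) has_real_derivative flat ([:0, 0, 1:] * (P - pderiv P)) x) (at x)"
      using neg by (auto simp: flat_def)
    ultimately show ?thesis by (subst DERIV_cong_ev[OF refl _ refl])
  qed
next
  case True
  have "((\<lambda>h. flat P h / h) \<longlongrightarrow> 0) (at_right 0)"
  proof -
    \<comment> \<open>The factor \<open>[:0, 1:]\<close> is the division by h in the difference
      quotient, as y = 1/h.\<close>
    have "((\<lambda>h. poly ([:0, 1:] * P) (inverse h) * exp (- inverse h)) \<longlongrightarrow> 0) (at_right 0)"
      by (rule filterlim_compose[OF poly_times_exp_minus_tendsto_0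
            filterlim_inverse_at_top_right])
    moreover have "\<forall>\<^sub>F h in at_right 0.
        poly ([:0, 1:] * P) (inverse h) * exp (- inverse h) = flat P h / h"
      by (auto simp: eventually_at_filter flat_def divide_simps)
    ultimately show ?thesis by (rule Lim_transform_eventually)
  qed
  moreover have "((\<lambda>h. flat P h / h) \<longlongrightarrow> 0) (at_left 0)"
    by (rule tendsto_eventually) (auto simp: eventually_at_filter flat_def)
  ultimately have "((\<lambda>h. flat P h / h) \<longlongrightarrow> 0) (at 0)"
    by (simp add: filterlim_at_split)
  then show ?thesis
    by (simp add: True DERIV_def flat_def)
qed

lemma C_k_flat: "C_k k (flat P)"
proof (induction k arbitrary: P)
  case 0
  show ?case
    using flat_has_derivative[of P]
    by (auto intro!: continuous_at_imp_continuous_on dest: DERIV_isCont)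
next
  case (Suc k)
  show ?case by (rule C_k_SucI_real[OF flat_has_derivative Suc])
qed

text \<open>The base point c - 1 lies to the left of everything that contributes, and an integral
  over an empty interval is 0; so this is an antiderivative on the whole line, including x < c -
  1.\<close>

lemma antiderivative_of_vanishing_left:
  fixes f :: "real \<Rightarrow> real"
  assumes "continuous_on UNIV f" and "\<And>x. x \<le> c \<Longrightarrow> f x = 0"
  shows "((\<lambda>x. integral {c - 1..x} f) has_real_derivative f x) (at x)"
proof (cases "x < c")
  case True
  have "\<forall>\<^sub>F y in nhds x. integral {c - 1..y} f = 0"
  proof (rule eventually_mono[OF eventually_nhds_in_open[of "{..<c}" x]])
    fix y assume "y \<in> {..<c}"
    then have "integral {c - 1..y} f = integral {c - 1..y} (\<lambda>x. 0)"
      by (intro integral_cong) (auto simp: assms)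
    then show "integral {c - 1..y} f = 0" by simp
  qed (use True in auto)
  moreover have "((\<lambda>x. 0) has_real_derivative f x) (at x)"
    using True assms by simp
  ultimately show ?thesis by (subst DERIV_cong_ev[OF refl _ refl])
next
  case False
  have "((\<lambda>x. integral {c - 1..x} f) has_real_derivative f x) (at x within {c - 1..x + 1})"
    by (rule integral_has_real_derivative)
      (use False assms in \<open>auto intro: continuous_on_subset\<close>)
  moreover have "at x within {c - 1..x + 1} = at x"
    by (rule at_within_interior) (use False in auto)
  ultimately show ?thesis by simp
qed

text \<open>\<open>S\<close> is the normalised integral of the bump exp(-1/x) exp(-1/(1-x)) on (0,
  1).\<close>

lemma smooth_step_exists:
  obtains S \<beta> :: "real \<Rightarrow> real" where
    "\<And>x. (S has_real_derivative \<beta> x) (at x)" "\<And>k. C_k k \<beta>" "\<And>x. \<beta> x \<ge> 0"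
    "\<And>x. x \<notin> {0<..<1} \<Longrightarrow> \<beta> x = 0" "\<And>x. x \<le> 0 \<Longrightarrow> S x = 0" "\<And>x. x \<ge> 1 \<Longrightarrow> S x = 1"
proof -
  define b where "b x = flat 1 x * flat 1 (1 - x)" for x
  have b_nonneg: "b x \<ge> 0" for x by (simp add: b_def flat_def)
  have b_pos: "b x > 0" if "x > 0" "x < 1" for x using that by (simp add: b_def flat_def)
  have b_out: "b x = 0" if "x \<notin> {0<..<1}" for x using that by (auto simp: b_def flat_def)
  have C: "C_k k b" for k
    using C_k_mult[OF C_k_flat C_k_compose_affine[OF _ C_k_flat], of uminus k 1 1 1]
    by (simp add: b_def[abs_def] bounded_linear_minus bounded_linear_ident)
  define s where "s x = integral {0 - 1..x} b" for x
  have cont: "continuous_on UNIV b" using C[of 0] by simp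
  have ds: "(s has_real_derivative b x) (at x)" for x
    unfolding s_def by (rule antiderivative_of_vanishing_left[OF cont]) (auto intro: b_out)
  have s0: "s x = 0" if "x \<le> 0" for x
  proof -
    have "s x = integral {0 - 1..x} (\<lambda>x. 0)"
      unfolding s_def by (intro integral_cong b_out) (use that in auto)
    then show ?thesis by simp
  qed
  have s1: "s x = s 1" if "x \<ge> 1" for x
  proof (cases "x = 1")
    case False
    show ?thesis
    proof (rule DERIV_isconst_end[where f = s])
      show "continuous_on {1..x} s" by (rule DERIV_continuous_on[OF DERIV_subset[OF ds]]) simp
      show "(s has_real_derivative 0) (at y)" if "1 < y" "y < x" for y
        using ds[of y] b_out[of y] that by simp
    qed (use that False in auto)
  qed simp
  have "s 0 < s 1"
  proof (rule DERIV_pos_imp_increasing_open[where f = s])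
    show "continuous_on {0..1} s" by (rule DERIV_continuous_on[OF DERIV_subset[OF ds]]) simp
    show "\<exists>y. (s has_real_derivative y) (at x) \<and> y > 0" if "0 < x" "x < 1" for x
      using ds b_pos[OF that] by blast
  qed simp
  then have pos: "s 1 > 0" by (simp add: s0)
  show thesis
  proof (rule that[of "\<lambda>x. (1 / s 1) * s x" "\<lambda>x. (1 / s 1) * b x"])
    show "((\<lambda>x. (1 / s 1) * s x) has_real_derivative (1 / s 1) * b x) (at x)" for x
      by (intro DERIV_cmult ds)
    show "C_k k (\<lambda>x. (1 / s 1) * b x)" for k by (intro C_k_mult C_k_const C)
    show "(1 / s 1) * s x = 1" if "x \<ge> 1" for x using s1[OF that] pos by simp
  qed (use pos b_nonneg b_out s0 in auto)
qed

section \<open>D'Alembert's formula for distributional solutions\<close>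

lemma null_product_has_derivative:
  fixes A B :: "real \<Rightarrow> real"
  assumes "\<And>x. (A has_real_derivative A' x) (at x)" "\<And>x. (B has_real_derivative B' x) (at x)"
  shows "((\<lambda>x. A (fst x + snd x) * B (fst x - snd x)) has_derivative
     (\<lambda>h. A (fst x + snd x) * (B' (fst x - snd x) * (fst h - snd h)) +
          A' (fst x + snd x) * (fst h + snd h) * B (fst x - snd x))) (at x)"
proof -
  have "((\<lambda>x. A (fst x + snd x)) has_derivative (\<lambda>h. A' (fst x + snd x) * (fst h + snd h))) (at x)"
    by (rule has_derivative_compose[where f = "\<lambda>x. fst x + snd x" and g = A])
      (use assms in \<open>auto intro!: derivative_eq_intros simp: has_field_derivative_def\<close>)
  moreover have "((\<lambda>x. B (fst x - snd x)) has_derivative (\<lambda>h. B' (fst x - snd x) * (fst h - snd h))) (at x)"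
    by (rule has_derivative_compose[where f = "\<lambda>x. fst x - snd x" and g = B])
      (use assms in \<open>auto intro!: derivative_eq_intros simp: has_field_derivative_def\<close>)
  ultimately show ?thesis by (rule has_derivative_mult)
qed

lemma
  fixes A B :: "real \<Rightarrow> real"
  assumes "\<And>x. (A has_real_derivative A' x) (at x)" "\<And>x. (B has_real_derivative B' x) (at x)"
  shows d0_null_product: "d0 (\<lambda>x. A (fst x + snd x) * B (fst x - snd x)) =
      (\<lambda>x. A (fst x + snd x) * B' (fst x - snd x) + A' (fst x + snd x) * B (fst x - snd x))"
    and d1_null_product: "d1 (\<lambda>x. A (fst x + snd x) * B (fst x - snd x)) =
      (\<lambda>x. A' (fst x + snd x) * B (fst x - snd x) - A (fst x + snd x) * B' (fst x - snd x))"
  using partial_eq[OF null_product_has_derivative[OF assms]] by (auto simp: fun_eq_iff)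

text \<open>The second time derivative is A''B + 2A'B' + AB'', the second space derivative A''B -
  2A'B' + AB''; only the mixed terms survive.\<close>

lemma dalembertian_null_product:
  fixes A B :: "real \<Rightarrow> real"
  assumes A: "\<And>x. (A has_real_derivative A' x) (at x)" "\<And>x. (A' has_real_derivative A'' x) (at x)"
    and B: "\<And>x. (B has_real_derivative B' x) (at x)" "\<And>x. (B' has_real_derivative B'' x) (at x)"
  shows "dalembertian (\<lambda>x. A (fst x + snd x) * B (fst x - snd x)) x =
    4 * A' (fst x + snd x) * B' (fst x - snd x)"
proof -
  note D1 = null_product_has_derivative[OF A(1) B(2)] and D2 = null_product_has_derivative[OF A(2) B(1)]
  show ?thesis
    unfolding dalembertian_def d0_null_product[OF A(1) B(1)] d1_null_product[OF A(1) B(1)]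
    unfolding partial_eq[OF has_derivative_add[OF D1 D2]] partial_eq[OF has_derivative_diff[OF D2 D1]]
    by (simp add: algebra_simps)
qed

section \<open>Integrals against concentrating kernels\<close>

lemma has_bochner_integral_nonneg_real:
  fixes f :: "'a \<Rightarrow> real"
  shows "has_bochner_integral M f x \<Longrightarrow> (\<And>x. f x \<ge> 0) \<Longrightarrow> x \<ge> 0"
  by (metis Bochner_Integration.integral_nonneg has_bochner_integral_integral_eq)

text \<open>The 1/2 is the Jacobian factor of the null coordinates. Nonnegativity permits a
  computation with \<open>nn_integral\<close>, where the order of integration can be exchanged at
  once: shift x for fixed t, exchange, then rescale t by 2.\<close>

lemma has_bochner_integral_null_product:
  fixes f g :: "real \<Rightarrow> real"
  assumes f: "has_bochner_integral lborel f F" "\<And>x. f x \<ge> 0"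
    and g: "has_bochner_integral lborel g G" "\<And>x. g x \<ge> 0"
  shows "has_bochner_integral lborel (\<lambda>x. f (fst x + snd x) * g (fst x - snd x)) (F * G / 2)"
proof (rule has_bochner_integral_nn_integral)
  have [measurable]: "f \<in> borel_measurable borel" "g \<in> borel_measurable borel"
    using f(1) g(1) by (auto dest: borel_measurable_has_bochner_integral)
  have F: "F \<ge> 0" "G \<ge> 0"
    using f g has_bochner_integral_nonneg_real by blast+
  have F': "(\<integral>\<^sup>+x. f x \<partial>lborel) = F" "(\<integral>\<^sup>+x. g x \<partial>lborel) = G"
    using f g F by (auto simp: nn_integral_eq_integral has_bochner_integral_iff)
  show "(\<lambda>x. f (fst x + snd x) * g (fst x - snd x)) \<in> borel_measurable lborel"
    by (simp flip: lborel_prod)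
  have "(\<integral>\<^sup>+x. f (fst x + snd x) * g (fst x - snd x) \<partial>lborel) =
      (\<integral>\<^sup>+t. \<integral>\<^sup>+x. f (t + x) * g (t - x) \<partial>lborel \<partial>lborel)"
    by (subst lborel_prod[symmetric], subst lborel.nn_integral_fst[symmetric]) (auto simp: split_beta')
  also have "\<dots> = (\<integral>\<^sup>+t. \<integral>\<^sup>+x. f x * g (2 * t - x) \<partial>lborel \<partial>lborel)"
  proof (rule nn_integral_cong)
    fix t :: real
    show "(\<integral>\<^sup>+x. f (t + x) * g (t - x) \<partial>lborel) = (\<integral>\<^sup>+x. f x * g (2 * t - x) \<partial>lborel)"
      by (subst nn_integral_real_affine[where c = 1 and t = t and f = "\<lambda>x. ennreal (f x * g (2 * t - x))"])
        (auto simp: algebra_simps)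
  qed
  also have "\<dots> = (\<integral>\<^sup>+x. \<integral>\<^sup>+t. f x * g (2 * t - x) \<partial>lborel \<partial>lborel)"
    by (rule lborel_pair.Fubini') simp
  also have "\<dots> = (\<integral>\<^sup>+x. f x * (G / 2) \<partial>lborel)"
  proof (rule nn_integral_cong)
    fix x :: real
    have "(\<integral>\<^sup>+t. f x * g (2 * t - x) \<partial>lborel) = f x * (\<integral>\<^sup>+t. g (- x + 2 * t) \<partial>lborel)"
      using f(2) g(2) by (simp add: ennreal_mult' nn_integral_cmult algebra_simps)
    also have "(\<integral>\<^sup>+t. g (- x + 2 * t) \<partial>lborel) = G / 2"
    proof -
      have "ennreal 2 * (\<integral>\<^sup>+t. g (- x + 2 * t) \<partial>lborel) = ennreal 2 * ennreal (G / 2)"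
        using nn_integral_real_affine[of "\<lambda>x. ennreal (g x)" 2 "- x"] F' F
          ennreal_mult[of 2 "G / 2"] by simp
      then show ?thesis
        by (simp add: ennreal_mult_cancel_left)
    qed
    finally show "(\<integral>\<^sup>+t. f x * g (2 * t - x) \<partial>lborel) = f x * (G / 2)"
      using f(2)[of x] F ennreal_mult[of "f x" "G / 2"] by simp
  qed
  also have "\<dots> = (\<integral>\<^sup>+x. ennreal (f x) * ennreal (G / 2) \<partial>lborel)"
    by (intro nn_integral_cong ennreal_mult) (use f(2) F in auto)
  also have "\<dots> = ennreal F * ennreal (G / 2)"
    by (subst nn_integral_multc) (simp_all add: F')
  also have "\<dots> = ennreal (F * G / 2)"
    using ennreal_mult[of F "G / 2"] F by simp
  finally show "(\<integral>\<^sup>+x. f (fst x + snd x) * g (fst x - snd x) \<partial>lborel) = ennreal (F * G / 2)" .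
  show "0 \<le> F * G / 2" using F by simp
qed (use assms in simp)

text \<open>The kernels live in balls shrinking to \<open>c\<close>, so continuity of
  \<open>h\<close> suffices, without a growth condition. The mass \<open>M\<close> is left free
  because it is 2 for the kernel in the plane and 1 for those on the line.\<close>

lemma approximate_identity:
  fixes h :: "'a::euclidean_space \<Rightarrow> real" and K :: "nat \<Rightarrow> 'a \<Rightarrow> real"
  assumes K: "\<And>n. has_bochner_integral lborel (K n) M" "\<And>n x. K n x \<ge> 0"
    and supp: "\<And>n x. K n x \<noteq> 0 \<Longrightarrow> dist x c \<le> r n" and r: "r \<longlonglongrightarrow> 0"
    and h: "continuous_on UNIV h"
  shows "\<And>n. integrable lborel (\<lambda>x. h x * K n x)"
    and "(\<lambda>n. LINT x|lborel. h x * K n x) \<longlonglongrightarrow> M * h c"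
proof -
  have [measurable]: "h \<in> borel_measurable borel"
    using h by (rule borel_measurable_continuous_onI)
  have [measurable]: "K n \<in> borel_measurable borel" for n
    using K(1)[of n] by (auto dest: borel_measurable_has_bochner_integral)
  show int: "integrable lborel (\<lambda>x. h x * K n x)" for n
  proof -
    have "bounded (h ` cball c (r n))"
      by (intro compact_imp_bounded compact_continuous_image)
        (use h in \<open>auto intro: continuous_on_subset\<close>)
    then obtain b where "\<forall>y\<in>h ` cball c (r n). norm y \<le> b"
      by (auto simp: bounded_iff)
    then have b: "norm (h x) \<le> b" if "dist x c \<le> r n" for x
      using that by (simp add: dist_commute)
    show ?thesis
    proof (rule Bochner_Integration.integrable_bound)
      show "integrable lborel (\<lambda>x. b * K n x)"
        using K(1)[of n] by (auto simp: has_bochner_integral_iff)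
      have "norm (h x * K n x) \<le> norm (b * K n x)" for x
      proof (cases "K n x = 0")
        case False
        from b[OF supp[OF False]] show ?thesis
          by (simp add: abs_mult mult_right_mono)
      qed simp
      then show "AE x in lborel. norm (h x * K n x) \<le> norm (b * K n x)" by simp
    qed simp
  qed
  have M: "M \<ge> 0" using K has_bochner_integral_nonneg_real by blast
  show "(\<lambda>n. LINT x|lborel. h x * K n x) \<longlonglongrightarrow> M * h c"
  proof (rule LIMSEQ_I)
    fix e :: real assume e: "e > 0"
    \<comment> \<open>The added 1 covers \<open>M = 0\<close>.\<close>
    define \<epsilon> where "\<epsilon> = e / (M + 1)"
    have \<epsilon>: "\<epsilon> > 0" using e M by (simp add: \<epsilon>_def)
    have "isCont h c" using h by (simp add: continuous_on_eq_continuous_at)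
    then obtain d where d: "d > 0" "\<And>x. dist x c < d \<Longrightarrow> dist (h x) (h c) < \<epsilon>"
      unfolding continuous_at_eps_delta using \<epsilon> by blast
    obtain N where N: "\<And>n. n \<ge> N \<Longrightarrow> \<bar>r n\<bar> < d"
      using LIMSEQ_D[OF r d(1)] by auto
    have "norm ((LINT x|lborel. h x * K n x) - M * h c) < e" if "n \<ge> N" for n
    proof -
      have KM: "integrable lborel (K n)" "integral\<^sup>L lborel (K n) = M"
        using K(1)[of n] by (auto simp: has_bochner_integral_iff)
      have "(LINT x|lborel. h x * K n x) - M * h c = (LINT x|lborel. h x * K n x - h c * K n x)"
        using int KM by simp
      also have "norm \<dots> \<le> (LINT x|lborel. \<epsilon> * K n x)"
      proof (rule Bochner_Integration.integral_norm_bound_integral)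
        fix x
        show "norm (h x * K n x - h c * K n x) \<le> \<epsilon> * K n x"
        proof (cases "K n x = 0")
          case False
          then have "dist x c < d" using supp[OF False] N[OF that] by linarith
          then have "\<bar>h x - h c\<bar> * K n x \<le> \<epsilon> * K n x"
            using d(2)[of x] K(2)[of n x] by (intro mult_right_mono) (auto simp: dist_real_def)
          then show ?thesis
            using K(2)[of n x] by (simp add: abs_mult flip: left_diff_distrib)
        qed simp
      qed (use int KM in auto)
      also have "\<dots> = \<epsilon> * M" using KM by simp
      also have "\<dots> < e" using e M by (simp add: \<epsilon>_def field_simps)
      finally show ?thesis .
    qed
    then show "\<exists>N. \<forall>n\<ge>N. norm ((LINT x|lborel. h x * K n x) - M * h c) < e" by blast
  qed
qed

text \<open>\<open>A l r e\<close> rises from 0 to 1 on [l, l + 1] and falls back to 0 on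
  [r, r + e]. Only the right ramp has variable width: as e tends to 0, its derivative becomes a
  negative delta function at r.\<close>

lemma plateau_exists:
  obtains A A' :: "real \<Rightarrow> real \<Rightarrow> real \<Rightarrow> real \<Rightarrow> real" and \<beta> :: "real \<Rightarrow> real" where
    "has_bochner_integral lborel \<beta> 1" "continuous_on UNIV \<beta>" "\<And>x. \<beta> x \<ge> 0"
    "\<And>x. x \<notin> {0<..<1} \<Longrightarrow> \<beta> x = 0"
    "\<And>l r e x. e > 0 \<Longrightarrow> (A l r e has_real_derivative A' l r e x) (at x)"
    "\<And>l r e k. e > 0 \<Longrightarrow> C_k k (A' l r e)"
    "\<And>l r e x. A' l r e x = \<beta> (x - l) - \<beta> ((x - r) / e) / e"
    "\<And>l r e x. e > 0 \<Longrightarrow> l + 1 \<le> r \<Longrightarrow> 0 \<le> A l r e x \<and> A l r e x \<le> 1"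
    "\<And>l r e x. e > 0 \<Longrightarrow> l + 1 \<le> x \<Longrightarrow> x \<le> r \<Longrightarrow> A l r e x = 1"
    "\<And>l r e x. e > 0 \<Longrightarrow> l + 1 \<le> r \<Longrightarrow> x \<le> l \<or> r + e \<le> x \<Longrightarrow> A l r e x = 0"
proof -
  obtain S \<beta> :: "real \<Rightarrow> real" where S: "\<And>x. (S has_real_derivative \<beta> x) (at x)"
    and \<beta>: "\<And>k. C_k k \<beta>" "\<And>x. \<beta> x \<ge> 0" "\<And>x. x \<notin> {0<..<1} \<Longrightarrow> \<beta> x = 0"
    and S0: "\<And>x. x \<le> 0 \<Longrightarrow> S x = 0" and S1: "\<And>x. x \<ge> 1 \<Longrightarrow> S x = 1"
    using smooth_step_exists by metis
  have mono: "S x \<le> S y" if "x \<le> y" for x y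
    by (rule DERIV_nonneg_imp_nondecreasing[OF that]) (use S \<beta>(2) in blast)
  have S_nonneg: "0 \<le> S x" for x using mono[of "min x 0" x] S0[of "min x 0"] by simp
  have S_le: "S x \<le> 1" for x using mono[of x "max x 1"] S1[of "max x 1"] by simp
  have cont: "continuous_on UNIV \<beta>" using \<beta>(1)[of 0] by simp
  have int: "has_bochner_integral lborel \<beta> 1"
  proof -
    have "has_bochner_integral lborel (\<lambda>x. \<beta> x * indicator {0..1} x) (S 1 - S 0)"
      by (rule has_bochner_integral_FTC_Icc_real)
        (use S cont in \<open>auto simp: continuous_on_eq_continuous_at\<close>)
    moreover have "\<beta> x * indicator {0..1} x = \<beta> x" for x
      using \<beta>(3)[of x] by (cases "x \<in> {0<..<1}") auto
    ultimately show ?thesis using S0 S1 by simp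
  qed
  define A where "A l r e x = S (x - l) - S ((x - r) / e)" for l r e x
  define A' where "A' l r e x = \<beta> (x - l) - \<beta> ((x - r) / e) / e" for l r e x
  show thesis
  proof (rule that[of \<beta> A A'])
    fix l r e x :: real assume e: "e > 0"
    show "(A l r e has_real_derivative A' l r e x) (at x)"
      unfolding A_def A'_def
      by (rule DERIV_cong, rule DERIV_diff[OF DERIV_chain2[OF S] DERIV_chain2[OF S]])
        (use e in \<open>auto intro!: derivative_eq_intros\<close>)
    show "C_k k (A' l r e)" for k
    proof -
      have "C_k k (\<lambda>x. \<beta> (1 * x + (- l)) + (- 1 / e) * \<beta> ((1 / e) * x + (- r / e)))"
        by (intro C_k_add C_k_mult C_k_const C_k_compose_affine \<beta> bounded_linear_mult_right)
      then show ?thesis by (simp add: A'_def[abs_def] diff_divide_distrib)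
    qed
    show "A l r e x = 1" if "l + 1 \<le> x" "x \<le> r"
      unfolding A_def using S1[of "x - l"] S0[of "(x - r) / e"] e that by (simp add: divide_nonpos_pos)
    show "A l r e x = 0" if "l + 1 \<le> r" "x \<le> l \<or> r + e \<le> x"
      using that(2)
    proof
      assume "x \<le> l"
      then show ?thesis unfolding A_def
        using S0[of "x - l"] S0[of "(x - r) / e"] e that(1) by (simp add: divide_nonpos_pos)
    next
      assume "r + e \<le> x"
      then show ?thesis unfolding A_def
        using S1[of "x - l"] S1[of "(x - r) / e"] e that(1) by simp
    qed
    show "0 \<le> A l r e x \<and> A l r e x \<le> 1" if "l + 1 \<le> r"
    proof (cases "x \<le> r")
      case True
      then show ?thesis
        using S0[of "(x - r) / e"] S_nonneg S_le e by (simp add: A_def divide_nonpos_pos)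
    next
      case False
      then show ?thesis
        using S1[of "x - l"] S_nonneg S_le that by (simp add: A_def)
    qed
  qed (use int cont \<beta> A'_def in auto)
qed

lemma scaled_bump_has_bochner_integral:
  fixes \<beta> :: "real \<Rightarrow> real"
  assumes "has_bochner_integral lborel \<beta> 1" and "e > 0"
  shows "has_bochner_integral lborel (\<lambda>x. \<beta> ((x - r) / e) / e) 1"
proof -
  have "has_bochner_integral lborel (\<lambda>x. \<beta> ((x - r) / e)) e"
    using assms lborel_has_bochner_integral_real_affine_iff[of "1 / e" \<beta> 1 "- r / e"]
    by (simp add: diff_divide_distrib)
  from has_bochner_integral_mult_right[of "1 / e", OF this] assms(2) show ?thesis by simp
qed

text \<open>The null coordinates \<open>t + x\<close> and \<open>t - x\<close> turn the wave operator into a multiple of the mixed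
  derivative, so a product of plateau functions in these coordinates approximates the indicator of
  the backward light cone of \<open>(t0, x0)\<close>, while its d'Alembertian concentrates at the apex. The lower
  ramps of the plateaus interact only at negative times.\<close>

lemma dalembert_test_functions:
  fixes U :: "real \<times> real \<Rightarrow> real"
  assumes dws: "distributional_wave_solution F U0 U1 U"
    and cont_U: "continuous_on UNIV Ue" "\<And>t x. t \<ge> 0 \<Longrightarrow> Ue (t, x) = U (t, x)"
    and cont_U0: "continuous_on UNIV U0" and int_U1: "integrable lborel U1" and t0: "t0 \<ge> 0"
  obtains \<phi> :: "nat \<Rightarrow> real \<times> real \<Rightarrow> real" where
    "\<And>n. continuous_on UNIV (\<phi> n)" "\<And>n x. 0 \<le> \<phi> n x \<and> \<phi> n x \<le> 1"
    "\<And>n t x. t \<ge> 0 \<Longrightarrow> t + x \<le> t0 + x0 \<Longrightarrow> t - x \<le> t0 - x0 \<Longrightarrow> \<phi> n (t, x) = 1"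
    "\<And>n t x. t0 + x0 + 1 / real (Suc n) \<le> t + x \<or> t0 - x0 + 1 / real (Suc n) \<le> t - x \<Longrightarrow>
      \<phi> n (t, x) = 0"
    "(\<lambda>n. F (\<phi> n)) \<longlonglongrightarrow>
      2 * U (t0, x0) - U0 (x0 + t0) - U0 (x0 - t0) - (LINT y:{x0 - t0..x0 + t0}|lborel. U1 y)"
proof -
  obtain A A' :: "real \<Rightarrow> real \<Rightarrow> real \<Rightarrow> real \<Rightarrow> real" and \<beta> :: "real \<Rightarrow> real"
    where \<beta>: "has_bochner_integral lborel \<beta> 1" "continuous_on UNIV \<beta>" "\<And>x. \<beta> x \<ge> 0"
      "\<And>x. x \<notin> {0<..<1} \<Longrightarrow> \<beta> x = 0"
    and dA: "\<And>l r e x. e > 0 \<Longrightarrow> (A l r e has_real_derivative A' l r e x) (at x)"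
    and CA': "\<And>l r e k. e > 0 \<Longrightarrow> C_k k (A' l r e)"
    and A': "\<And>l r e x. A' l r e x = \<beta> (x - l) - \<beta> ((x - r) / e) / e"
    and A_bounds: "\<And>l r e x. e > 0 \<Longrightarrow> l + 1 \<le> r \<Longrightarrow> 0 \<le> A l r e x \<and> A l r e x \<le> 1"
    and A_1: "\<And>l r e x. e > 0 \<Longrightarrow> l + 1 \<le> x \<Longrightarrow> x \<le> r \<Longrightarrow> A l r e x = 1"
    and A_0: "\<And>l r e x. e > 0 \<Longrightarrow> l + 1 \<le> r \<Longrightarrow> x \<le> l \<or> r + e \<le> x \<Longrightarrow> A l r e x = 0"
    by (rule plateau_exists) blast
  define u v where "u = t0 + x0" and "v = t0 - x0"
  have uv: "u + v \<ge> 0" using t0 by (simp add: u_def v_def)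
  define e where "e n = 1 / real (Suc n)" for n
  have e: "e n > 0" "e n \<le> 1" for n by (auto simp: e_def)
  have e_lim: "e \<longlonglongrightarrow> 0" unfolding e_def[abs_def] by (rule LIMSEQ_Suc) (rule lim_1_over_n)
  \<comment> \<open>At times t \<ge> 0 the null coordinates add up to 2 t \<ge> 0, so inside the
    cone t + x \<ge> - v and t - x \<ge> - u. The left ramps lie below these bounds; ending them at
    - v - 2 and - u - 2 leaves a margin larger than the width \<open>e n\<close> \<le> 1 of the
    right ramps.\<close>
  define a where "a n = A (- v - 3) u (e n)" for n
  define a' where "a' n = A' (- v - 3) u (e n)" for n
  define b where "b n = A (- u - 3) v (e n)" for n
  define b' where "b' n = A' (- u - 3) v (e n)" for n
  define \<kappa> where "\<kappa> r n x = \<beta> ((x - r) / e n) / e n" for r n x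
  have \<kappa>: "has_bochner_integral lborel (\<kappa> r n) 1" "\<kappa> r n x \<ge> 0" for r n x
    using scaled_bump_has_bochner_integral[OF \<beta>(1) e(1)] \<beta>(3) e(1)[of n]
    by (auto simp: \<kappa>_def[abs_def] less_imp_le)
  have \<kappa>_supp: "r < x \<and> x < r + e n" if "\<kappa> r n x \<noteq> 0" for r n x
    using that \<beta>(4)[of "(x - r) / e n"] e(1)[of n] by (force simp: \<kappa>_def field_simps)
  have da: "(a n has_real_derivative a' n x) (at x)" "(b n has_real_derivative b' n x) (at x)" for n x
    unfolding a_def a'_def b_def b'_def by (rule dA[OF e(1)])+
  have C': "C_k k (a' n)" "C_k k (b' n)" for k n
    unfolding a'_def b'_def by (rule CA'[OF e(1)])+
  have C: "C_k k (a n)" "C_k k (b n)" for k n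
    using C_k_SucI_real[OF da(1) C'(1)] C_k_SucI_real[OF da(2) C'(2)] by (blast intro: C_k_SucD)+
  have ab_bounds: "0 \<le> a n x" "a n x \<le> 1" "0 \<le> b n x" "b n x \<le> 1" for n x
    using A_bounds[OF e(1)] uv by (auto simp: a_def b_def)
  have a_1: "a n x = 1" if "- v - 2 \<le> x" "x \<le> u" for n x
    unfolding a_def by (rule A_1[OF e(1)]) (use that in auto)
  have b_1: "b n x = 1" if "- u - 2 \<le> x" "x \<le> v" for n x
    unfolding b_def by (rule A_1[OF e(1)]) (use that in auto)
  have a_0: "a n x = 0" if "x \<le> - v - 3 \<or> u + e n \<le> x" for n x
    unfolding a_def by (rule A_0[OF e(1)]) (use that uv in auto)
  have b_0: "b n x = 0" if "x \<le> - u - 3 \<or> v + e n \<le> x" for n x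
    unfolding b_def by (rule A_0[OF e(1)]) (use that uv in auto)
  have a'_eq: "a' n x = - \<kappa> u n x" if "- v - 2 \<le> x" for n x
    using that \<beta>(4)[of "x - (- v - 3)"] by (simp add: a'_def A' \<kappa>_def)
  have b'_eq: "b' n x = - \<kappa> v n x" if "- u - 2 \<le> x" for n x
    using that \<beta>(4)[of "x - (- u - 3)"] by (simp add: b'_def A' \<kappa>_def)
  have a'_0: "a' n x = 0" if "x > u + e n" for n x
  proof -
    have "x - (- v - 3) \<ge> 1" using that uv e(1)[of n] by linarith
    then have "\<beta> (x - (- v - 3)) = 0" by (intro \<beta>(4)) simp
    moreover have "\<kappa> u n x = 0" using \<kappa>_supp[of u n x] that by fastforce
    ultimately show ?thesis by (simp add: a'_def A' \<kappa>_def)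
  qed
  have b'_0: "b' n x = 0" if "x > v + e n" for n x
  proof -
    have "x - (- u - 3) \<ge> 1" using that uv e(1)[of n] by linarith
    then have "\<beta> (x - (- u - 3)) = 0" by (intro \<beta>(4)) simp
    moreover have "\<kappa> v n x = 0" using \<kappa>_supp[of v n x] that by fastforce
    ultimately show ?thesis by (simp add: b'_def A' \<kappa>_def)
  qed
  define \<phi> where "\<phi> n x = a n (fst x + snd x) * b n (fst x - snd x)" for n and x :: "real \<times> real"
  have C\<phi>: "C_k k (\<phi> n)" for k n
  proof -
    have "C_k k (\<lambda>x::real \<times> real. a n ((fst x + snd x) + 0) * b n ((fst x - snd x) + 0))"
      by (intro C_k_mult C_k_compose_affine C bounded_linear_add bounded_linear_sub
          bounded_linear_fst bounded_linear_snd)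
    then show ?thesis by (simp add: \<phi>_def[abs_def])
  qed
  have test: "test_function (\<phi> n)" for n
  proof -
    define c where "c = \<bar>u\<bar> + \<bar>v\<bar> + 4"
    have "support_on UNIV (\<phi> n) \<subseteq> cbox (- c, - c) (c, c)"
    proof
      fix x assume "x \<in> support_on UNIV (\<phi> n)"
      then have "a n (fst x + snd x) \<noteq> 0" "b n (fst x - snd x) \<noteq> 0"
        by (auto simp: support_on_def \<phi>_def)
      then have "- v - 3 < fst x + snd x" "fst x + snd x < u + e n"
        "- u - 3 < fst x - snd x" "fst x - snd x < v + e n"
        using a_0 b_0 by (meson not_le)+
      then show "x \<in> cbox (- c, - c) (c, c)"
        using e(2)[of n] by (cases x) (auto simp: c_def cbox_Pair_eq)
    qed
    then have "bounded (support_on UNIV (\<phi> n))" by (rule bounded_subset[OF bounded_cbox])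
    then show ?thesis
      using C\<phi> by (simp add: test_function_def smooth_def compact_support_def compact_closure)
  qed
  \<comment> \<open>The mass 4 * (1/2) becomes the coefficient 2 of \<open>U (t0, x0)\<close>. The
    kernel lives at times above t0, where \<open>Ue\<close> agrees with \<open>U\<close>.\<close>
  have "(\<lambda>n. LINT x|lborel. Ue x * (4 * (\<kappa> u n (fst x + snd x) * \<kappa> v n (fst x - snd x))))
      \<longlonglongrightarrow> 4 * (1 * 1 / 2) * Ue (t0, x0)"
  proof (rule approximate_identity(2)[where r = "\<lambda>n. 2 * e n"])
    show "has_bochner_integral lborel
        (\<lambda>x. 4 * (\<kappa> u n (fst x + snd x) * \<kappa> v n (fst x - snd x))) (4 * (1 * 1 / 2))" for n
      by (intro has_bochner_integral_mult_right has_bochner_integral_null_product \<kappa>)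
    show "4 * (\<kappa> u n (fst x + snd x) * \<kappa> v n (fst x - snd x)) \<ge> 0" for n and x :: "real \<times> real"
      using \<kappa>(2) by simp
    show "dist x (t0, x0) \<le> 2 * e n"
      if "4 * (\<kappa> u n (fst x + snd x) * \<kappa> v n (fst x - snd x)) \<noteq> 0" for n and x :: "real \<times> real"
    proof -
      have "u < fst x + snd x" "fst x + snd x < u + e n" "v < fst x - snd x" "fst x - snd x < v + e n"
        using \<kappa>_supp that by fastforce+
      then have "\<bar>fst x - t0\<bar> \<le> e n" "\<bar>snd x - x0\<bar> \<le> e n" unfolding u_def v_def by linarith+
      then show ?thesis
        using sqrt_sum_squares_le_sum_abs[of "fst x - t0" "snd x - x0"]
        by (cases x) (auto simp: dist_Pair_Pair dist_real_def)
    qed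
    show "(\<lambda>n. 2 * e n) \<longlonglongrightarrow> 0" using tendsto_mult_right_zero[OF e_lim] by simp
  qed (rule cont_U)
  moreover have "(LINT x|lborel. Ue x * (4 * (\<kappa> u n (fst x + snd x) * \<kappa> v n (fst x - snd x)))) =
      (LINT x:{0..} \<times> UNIV|lborel. U x * dalembertian (\<phi> n) x)" for n
    unfolding set_lebesgue_integral_def
  proof (rule Bochner_Integration.integral_cong[OF refl])
    fix x :: "real \<times> real"
    obtain t y where x: "x = (t, y)" by force
    have dal: "dalembertian (\<phi> n) x = 4 * a' n (t + y) * b' n (t - y)"
    proof -
      from C_k_Suc_has_real_derivative[OF C'(1)] C_k_Suc_has_real_derivative[OF C'(2)]
      show ?thesis
        unfolding \<phi>_def[abs_def] x
        by (subst dalembertian_null_product[OF da(1) _ da(2)]) auto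
    qed
    show "Ue x * (4 * (\<kappa> u n (fst x + snd x) * \<kappa> v n (fst x - snd x))) =
        indicator ({0..} \<times> UNIV) x *\<^sub>R (U x * dalembertian (\<phi> n) x)"
    proof (cases "t \<ge> 0")
      case True
      have "a' n (t + y) * b' n (t - y) = \<kappa> u n (t + y) * \<kappa> v n (t - y)"
      proof (cases "t + y \<ge> - v - 2 \<and> t - y \<ge> - u - 2")
        case True
        then show ?thesis by (simp add: a'_eq b'_eq)
      next
        case False
        \<comment> \<open>At t \<ge> 0, one null coordinate lying as low as its left ramp puts the
          other one past its right ramp, where the derivative of its plateau vanishes.\<close>
        then consider "t + y < - v - 2" "t - y > v + e n" | "t - y < - u - 2" "t + y > u + e n"
          using \<open>t \<ge> 0\<close> e(2)[of n] by force
        then show ?thesis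
        proof cases
          case 1
          then have "\<kappa> v n (t - y) = 0" using \<kappa>_supp[of v n "t - y"] by fastforce
          with b'_0[OF 1(2)] show ?thesis by simp
        next
          case 2
          then have "\<kappa> u n (t + y) = 0" using \<kappa>_supp[of u n "t + y"] by fastforce
          with a'_0[OF 2(2)] show ?thesis by simp
        qed
      qed
      then show ?thesis using True cont_U(2)[OF True] by (simp add: x dal[unfolded x])
    next
      case False
      \<comment> \<open>The two right ramps meet only where 2 t > u + v = 2 t0, hence never at
        negative times.\<close>
      then have "\<not> (u < t + y \<and> v < t - y)" using uv by linarith
      then have "\<kappa> u n (t + y) * \<kappa> v n (t - y) = 0" using \<kappa>_supp by fastforce
      then show ?thesis using False by (simp add: x)
    qed
  qed
  ultimately have lim_U: "(\<lambda>n. LINT x:{0..} \<times> UNIV|lborel. U x * dalembertian (\<phi> n) x)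
      \<longlonglongrightarrow> 2 * U (t0, x0)"
    using cont_U(2)[OF t0] by simp
  have lim_U1: "(\<lambda>n. LINT y|lborel. U1 y * \<phi> n (0, y)) \<longlonglongrightarrow> (LINT y:{x0 - t0..x0 + t0}|lborel. U1 y)"
    unfolding set_lebesgue_integral_def
  proof (rule integral_dominated_convergence[where w = "\<lambda>y. norm (U1 y)"])
    have [measurable]: "\<phi> n \<in> borel_measurable borel" for n
      using C\<phi>[of 0 n] by (auto intro: borel_measurable_continuous_onI)
    have [measurable]: "U1 \<in> borel_measurable borel" using int_U1 by auto
    show "(\<lambda>y. U1 y * \<phi> n (0, y)) \<in> borel_measurable lborel" for n by measurable
    show "(\<lambda>y. indicator {x0 - t0..x0 + t0} y *\<^sub>R U1 y) \<in> borel_measurable lborel" by measurable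
    show "AE y in lborel. norm (U1 y * \<phi> n (0, y)) \<le> norm (U1 y)" for n
      using ab_bounds by (auto simp: \<phi>_def abs_mult intro!: mult_left_le mult_le_one)
    show "AE y in lborel. (\<lambda>n. U1 y * \<phi> n (0, y)) \<longlonglongrightarrow> indicator {x0 - t0..x0 + t0} y *\<^sub>R U1 y"
    proof (rule AE_I2)
      fix y
      consider "- v \<le> y \<and> y \<le> u" | "y < - v" | "y > u" by linarith
      then show "(\<lambda>n. U1 y * \<phi> n (0, y)) \<longlonglongrightarrow> indicator {x0 - t0..x0 + t0} y *\<^sub>R U1 y"
      proof cases
        case 1
        then have "\<phi> n (0, y) = 1" for n by (simp add: \<phi>_def a_1 b_1)
        then show ?thesis using 1 by (simp add: u_def v_def)
      next
        case 2
        then have "\<forall>\<^sub>F n in sequentially. e n < - v - y"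
          using order_tendstoD(2)[OF e_lim] by simp
        then have "\<forall>\<^sub>F n in sequentially. U1 y * \<phi> n (0, y) = 0"
          by eventually_elim (simp add: \<phi>_def b_0)
        then show ?thesis using 2 by (auto simp: v_def intro!: tendsto_eventually)
      next
        case 3
        then have "\<forall>\<^sub>F n in sequentially. e n < y - u"
          using order_tendstoD(2)[OF e_lim] by simp
        then have "\<forall>\<^sub>F n in sequentially. U1 y * \<phi> n (0, y) = 0"
          by eventually_elim (simp add: \<phi>_def a_0)
        then show ?thesis using 3 by (auto simp: u_def intro!: tendsto_eventually)
      qed
    qed
  qed (use int_U1 in auto)
  have \<kappa>_lim: "(\<lambda>n. LINT y|lborel. h y * \<kappa> r n y) \<longlonglongrightarrow> h r" "integrable lborel (\<lambda>y. h y * \<kappa> r n y)"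
    if "continuous_on UNIV h" for h :: "real \<Rightarrow> real" and r n
  proof -
    have "dist x r \<le> e n" if "\<kappa> r n x \<noteq> 0" for n x
      using \<kappa>_supp[OF that] by (simp add: dist_real_def)
    note ai = approximate_identity[OF \<kappa> this e_lim \<open>continuous_on UNIV h\<close>]
    from ai(2) show "(\<lambda>n. LINT y|lborel. h y * \<kappa> r n y) \<longlonglongrightarrow> h r" by simp
    from ai(1) show "integrable lborel (\<lambda>y. h y * \<kappa> r n y)" .
  qed
  have cont_U0': "continuous_on UNIV (\<lambda>y. U0 (- y))"
    by (rule continuous_on_compose2[OF cont_U0]) (auto intro: continuous_intros)
  have "(\<lambda>n. (LINT y|lborel. U0 y * \<kappa> u n y) + (LINT y|lborel. U0 (- y) * \<kappa> v n y))
      \<longlonglongrightarrow> U0 u + U0 (- v)"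
    by (intro tendsto_add \<kappa>_lim cont_U0 cont_U0')
  moreover have "(LINT y|lborel. U0 y * \<kappa> u n y) + (LINT y|lborel. U0 (- y) * \<kappa> v n y) =
      - (LINT y|lborel. U0 y * d0 (\<phi> n) (0, y))" for n
  proof -
    \<comment> \<open>At time 0 the left ramp of each factor meets a zero of the other one and the
      right ramp meets its plateau. What remains are two negative delta sequences, at x0 + t0 and x0
      - t0.\<close>
    have d0: "d0 (\<phi> n) (0, y) = - \<kappa> u n y - \<kappa> v n (- y)" for y
    proof -
      have "a' n y * b n (- y) = - \<kappa> u n y"
      proof (cases "y < - v - 2")
        case True
        then have "\<kappa> u n y = 0" using \<kappa>_supp[of u n y] uv by fastforce
        then show ?thesis using True e(2)[of n] by (simp add: b_0)
      next
        case False
        then have "\<kappa> u n y = 0 \<or> b n (- y) = 1"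
          using \<kappa>_supp[of u n y] uv e(2)[of n] by (force intro!: b_1)
        then show ?thesis using False by (auto simp: a'_eq)
      qed
      moreover have "a n y * b' n (- y) = - \<kappa> v n (- y)"
      proof (cases "- y < - u - 2")
        case True
        then have "\<kappa> v n (- y) = 0" using \<kappa>_supp[of v n "- y"] uv by fastforce
        then show ?thesis using True e(2)[of n] by (simp add: a_0)
      next
        case False
        then have "\<kappa> v n (- y) = 0 \<or> a n y = 1"
          using \<kappa>_supp[of v n "- y"] uv e(2)[of n] by (force intro!: a_1)
        then show ?thesis using False by (auto simp: b'_eq)
      qed
      ultimately show ?thesis
        unfolding \<phi>_def[abs_def] d0_null_product[OF da] by simp
    qed
    have int: "has_bochner_integral lborel (\<lambda>y. U0 (- y) * \<kappa> v n y) (LINT y|lborel. U0 (- y) * \<kappa> v n y)"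
      using \<kappa>_lim(2)[OF cont_U0', of v n] by (rule has_bochner_integral_integrable)
    then have int': "has_bochner_integral lborel (\<lambda>y. U0 y * \<kappa> v n (- y)) (LINT y|lborel. U0 (- y) * \<kappa> v n y)"
      using lborel_has_bochner_integral_real_affine_iff[of "- 1" "\<lambda>y. U0 (- y) * \<kappa> v n y" _ 0] by simp
    have "(LINT y|lborel. U0 y * d0 (\<phi> n) (0, y)) =
        (LINT y|lborel. - (U0 y * \<kappa> u n y) - U0 y * \<kappa> v n (- y))"
      by (simp add: d0 algebra_simps)
    also have "\<dots> = - (LINT y|lborel. U0 y * \<kappa> u n y) - (LINT y|lborel. U0 (- y) * \<kappa> v n y)"
      using int' \<kappa>_lim(2)[OF cont_U0, of u n] by (simp add: has_bochner_integral_iff)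
    finally show ?thesis by simp
  qed
  ultimately have lim_U0: "(\<lambda>n. - (LINT y|lborel. U0 y * d0 (\<phi> n) (0, y))) \<longlonglongrightarrow> U0 u + U0 (- v)"
    by simp
  have "F (\<phi> n) = (LINT x:{0..} \<times> UNIV|lborel. U x * dalembertian (\<phi> n) x)
      - (LINT y|lborel. U1 y * \<phi> n (0, y)) - (- (LINT y|lborel. U0 y * d0 (\<phi> n) (0, y)))" for n
    using dws test[of n] unfolding distributional_wave_solution_def by fastforce
  then have "(\<lambda>n. F (\<phi> n)) \<longlonglongrightarrow>
      2 * U (t0, x0) - (LINT y:{x0 - t0..x0 + t0}|lborel. U1 y) - (U0 u + U0 (- v))"
    by (simp only:) (intro tendsto_diff lim_U lim_U1 lim_U0)
  then have "(\<lambda>n. F (\<phi> n)) \<longlonglongrightarrow>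
      2 * U (t0, x0) - U0 (x0 + t0) - U0 (x0 - t0) - (LINT y:{x0 - t0..x0 + t0}|lborel. U1 y)"
    by (simp add: u_def v_def algebra_simps)
  moreover have "\<phi> n (t, x) = 1" if "t \<ge> 0" "t + x \<le> t0 + x0" "t - x \<le> t0 - x0" for n t x
  proof -
    have "a n (t + x) = 1" "b n (t - x) = 1"
      by (intro a_1 b_1; use that in \<open>simp add: u_def v_def\<close>)+
    then show ?thesis by (simp add: \<phi>_def)
  qed
  moreover have "\<phi> n (t, x) = 0"
    if "t0 + x0 + 1 / real (Suc n) \<le> t + x \<or> t0 - x0 + 1 / real (Suc n) \<le> t - x" for n t x
    using that a_0[of "t + x" n] b_0[of "t - x" n] by (auto simp: \<phi>_def u_def v_def e_def)
  moreover have "continuous_on UNIV (\<phi> n)" for n using C\<phi>[of 0 n] by simp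
  moreover have "0 \<le> \<phi> n x \<and> \<phi> n x \<le> 1" for n x
    using ab_bounds by (simp add: \<phi>_def mult_le_one)
  ultimately show thesis by (intro that[of \<phi>]) blast+
qed

section \<open>The free wave\<close>

lemma C_k_Suc_has_derivative_prod:
  fixes g :: "real \<times> real \<Rightarrow> real"
  assumes "C_k (Suc k) g"
  shows "(g has_derivative (\<lambda>h. fst h * d0 g p + snd h * d1 g p)) (at p)"
proof -
  have d: "(g has_derivative frechet_derivative g (at p)) (at p)"
    by (rule C_k_Suc_has_derivative[OF assms])
  have "frechet_derivative g (at p) h = fst h * d0 g p + snd h * d1 g p" for h
  proof -
    have "h = fst h *\<^sub>R (1, 0) + snd h *\<^sub>R (0, 1)" by (cases h) simp
    then have "frechet_derivative g (at p) h =
        frechet_derivative g (at p) (fst h *\<^sub>R (1, 0)) + frechet_derivative g (at p) (snd h *\<^sub>R (0, 1))"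
      by (metis linear_add has_derivative_linear[OF d])
    then show ?thesis
      by (simp only: linear_scale[OF has_derivative_linear[OF d]] partial_def real_scaleR_def)
  qed
  then have "frechet_derivative g (at p) = (\<lambda>h. fst h * d0 g p + snd h * d1 g p)" by blast
  with d show ?thesis by metis
qed

lemma C_k_Suc_has_real_derivative_along:
  fixes g :: "real \<times> real \<Rightarrow> real"
  assumes "C_k (Suc k) g"
    and "(f has_real_derivative f') (at s)" and "(h has_real_derivative h') (at s)"
  shows "((\<lambda>s. g (f s, h s)) has_real_derivative f' * d0 g (f s, h s) + h' * d1 g (f s, h s)) (at s)"
proof -
  have "((\<lambda>s. (f s, h s)) has_derivative (\<lambda>x. (f' * x, h' * x))) (at s)"
    using assms(2,3) by (intro has_derivative_Pair) (simp_all add: has_field_derivative_def)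
  from has_derivative_compose[OF this C_k_Suc_has_derivative_prod[OF assms(1)]]
  show ?thesis
    unfolding has_field_derivative_def
    by (rule has_derivative_eq_rhs) (simp add: fun_eq_iff algebra_simps)
qed

text \<open>The mean value theorem, once in each variable. Only one order of differentiation occurs,
  so that the lemma can be applied to either order and the results compared.\<close>

lemma second_difference:
  fixes f :: "real \<Rightarrow> real \<Rightarrow> real"
  assumes f1: "\<And>s r. ((\<lambda>s. f s r) has_real_derivative f1 s r) (at s)"
    and f12: "\<And>s r. ((\<lambda>r. f1 s r) has_real_derivative f12 s r) (at r)"
    and h: "h > 0"
  obtains \<xi> \<eta> where "0 < \<xi>" "\<xi> < h" "0 < \<eta>" "\<eta> < h"
    "f (t + h) (y + h) - f (t + h) y - f t (y + h) + f t y = h\<^sup>2 * f12 (t + \<xi>) (y + \<eta>)"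
proof -
  have "\<exists>z. t < z \<and> z < t + h \<and> (f (t + h) (y + h) - f (t + h) y) - (f t (y + h) - f t y) =
      (t + h - t) * (f1 z (y + h) - f1 z y)"
    by (rule MVT2[of t "t + h" "\<lambda>s. f s (y + h) - f s y"]) (use h f1 in \<open>auto intro: DERIV_diff\<close>)
  then obtain z where z: "t < z" "z < t + h"
    "(f (t + h) (y + h) - f (t + h) y) - (f t (y + h) - f t y) = h * (f1 z (y + h) - f1 z y)"
    by auto
  have "\<exists>w. y < w \<and> w < y + h \<and> f1 z (y + h) - f1 z y = (y + h - y) * f12 z w"
    by (rule MVT2[of y "y + h" "f1 z"]) (use h f12 in auto)
  then obtain w where w: "y < w" "w < y + h" "f1 z (y + h) - f1 z y = h * f12 z w" by auto
  show thesis
    by (rule that[of "z - t" "w - y"]) (use z w in \<open>auto simp: power2_eq_square\<close>)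
qed

text \<open>Schwarz's theorem: the second difference over a square of side h is h^2 times either
  iterated partial, each taken at a point within 2 h of the corner; continuity of both gives
  equality in the limit.\<close>

lemma mixed_partials_eq:
  fixes f :: "real \<times> real \<Rightarrow> real"
  assumes "C_k 2 f"
  shows "d0 (d1 f) = d1 (d0 f)"
proof
  fix x :: "real \<times> real"
  obtain t y where x: "x = (t, y)" by force
  have C2: "C_k (Suc (Suc 0)) f" using assms by (simp add: numeral_2_eq_2)
  then have C: "C_k (Suc 0) f" by (rule C_k_SucD)
  have C01: "C_k (Suc 0) (d0 f)" "C_k (Suc 0) (d1 f)"
    using C2 by (auto simp: Basis_prod_def)
  have cont: "continuous_on UNIV (d0 (d1 f))" "continuous_on UNIV (d1 (d0 f))"
    using C01 by (auto simp: Basis_prod_def)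
  have near: "\<exists>p q. dist p x \<le> 2 * h \<and> dist q x \<le> 2 * h \<and> d0 (d1 f) p = d1 (d0 f) q" if h: "h > 0" for h
  proof -
    have "((\<lambda>s. f (s, r)) has_real_derivative d0 f (s, r)) (at s)"
      "((\<lambda>r. d0 f (s, r)) has_real_derivative d1 (d0 f) (s, r)) (at r)"
      "((\<lambda>r. f (s, r)) has_real_derivative d1 f (s, r)) (at r)"
      "((\<lambda>s. d1 f (s, r)) has_real_derivative d0 (d1 f) (s, r)) (at s)" for s r
      using C_k_Suc_has_real_derivative_along[OF C DERIV_ident DERIV_const]
        C_k_Suc_has_real_derivative_along[OF C DERIV_const DERIV_ident]
        C_k_Suc_has_real_derivative_along[OF C01(1) DERIV_const DERIV_ident]
        C_k_Suc_has_real_derivative_along[OF C01(2) DERIV_ident DERIV_const] by simp_all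
    note d = this
    obtain \<xi> \<eta> where 1: "0 < \<xi>" "\<xi> < h" "0 < \<eta>" "\<eta> < h"
      "f (t + h, y + h) - f (t + h, y) - f (t, y + h) + f (t, y) = h\<^sup>2 * d1 (d0 f) (t + \<xi>, y + \<eta>)"
      by (rule second_difference[of "\<lambda>s r. f (s, r)" "\<lambda>s r. d0 f (s, r)", OF d(1,2) h])
    obtain \<xi>' \<eta>' where 2: "0 < \<xi>'" "\<xi>' < h" "0 < \<eta>'" "\<eta>' < h"
      "f (t + h, y + h) - f (t, y + h) - f (t + h, y) + f (t, y) = h\<^sup>2 * d0 (d1 f) (t + \<eta>', y + \<xi>')"
      by (rule second_difference[of "\<lambda>r s. f (s, r)" "\<lambda>r s. d1 f (s, r)", OF d(3,4) h])
    have dist: "dist (t + \<xi>, y + \<eta>) x \<le> 2 * h" if "0 < \<xi>" "\<xi> < h" "0 < \<eta>" "\<eta> < h" for \<xi> \<eta>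
      using sqrt_sum_squares_le_sum_abs[of \<xi> \<eta>] that
      by (simp add: x dist_Pair_Pair dist_real_def)
    have "h\<^sup>2 * d1 (d0 f) (t + \<xi>, y + \<eta>) = h\<^sup>2 * d0 (d1 f) (t + \<eta>', y + \<xi>')"
      using 1(5) 2(5) by linarith
    then show ?thesis
      using h dist[OF 1(1-4)] dist[OF 2(3,4,1,2)]
      by (intro exI[of _ "(t + \<eta>', y + \<xi>')"] exI[of _ "(t + \<xi>, y + \<eta>)"]) simp
  qed
  have "\<exists>p q. dist p x \<le> 2 * (1 / real (Suc n)) \<and> dist q x \<le> 2 * (1 / real (Suc n)) \<and>
      d0 (d1 f) p = d1 (d0 f) q" for n
    by (rule near) simp
  then obtain p q where p: "\<And>n. dist (p n) x \<le> 2 * (1 / real (Suc n))"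
    and q: "\<And>n. dist (q n) x \<le> 2 * (1 / real (Suc n))"
    and pq: "\<And>n. d0 (d1 f) (p n) = d1 (d0 f) (q n)" by metis
  have lim: "(\<lambda>n. 2 * (1 / real (Suc n))) \<longlonglongrightarrow> 0"
    by (intro tendsto_mult_right_zero LIMSEQ_Suc lim_1_over_n)
  have "p \<longlonglongrightarrow> x"
    by (rule metric_tendsto_imp_tendsto[OF lim]) (use p in \<open>simp add: dist_real_def\<close>)
  moreover have "q \<longlonglongrightarrow> x"
    by (rule metric_tendsto_imp_tendsto[OF lim]) (use q in \<open>simp add: dist_real_def\<close>)
  ultimately have "(\<lambda>n. d0 (d1 f) (p n)) \<longlonglongrightarrow> d0 (d1 f) x" "(\<lambda>n. d1 (d0 f) (q n)) \<longlonglongrightarrow> d1 (d0 f) x"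
    using cont by (blast intro: isCont_tendsto_compose continuous_on_interior[of UNIV] UNIV_I
        interior_UNIV[THEN equalityD2, THEN subsetD])+
  then show "d0 (d1 f) x = d1 (d0 f) x"
    using LIMSEQ_unique by (simp add: pq)
qed

text \<open>The method of characteristics: d0 V - d1 V is constant on the lines x - t = c, and this
  prescribes the derivative of V along the lines of constant x + t. Using an antiderivative
  \<open>I\<close> of \<open>V1\<close> covers both signs of t.\<close>

lemma
  assumes V: "free_wave_solution V0 V1 V"
    and I: "\<And>x. (I has_real_derivative V1 x) (at x)"
  shows free_wave_solution_dalembert:
      "V (t, x) = (V0 (x + t) + V0 (x - t)) / 2 + (I (x + t) - I (x - t)) / 2"
    and free_wave_solution_d1:
      "d1 V (t, x) = (partial 1 V0 (x + t) + partial 1 V0 (x - t)) / 2 + (V1 (x + t) - V1 (x - t)) / 2"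
proof -
  have wave: "d0 (d0 V) p = d1 (d1 V) p" for p
    using V unfolding free_wave_solution_def dalembertian_def by (metis eq_iff_diff_eq_0)
  have "C_k 2 V" using V by (simp add: free_wave_solution_def)
  then have C2: "C_k (Suc (Suc 0)) V" by (simp add: numeral_2_eq_2)
  then have C: "C_k (Suc 0) V" by (rule C_k_SucD)
  have C01: "C_k (Suc 0) (d0 V)" "C_k (Suc 0) (d1 V)"
    using C2 by (auto simp: Basis_prod_def)
  have V_0: "V (0, y) = V0 y" "d0 V (0, y) = V1 y" for y
    using V by (auto simp: free_wave_solution_def)
  have dV0: "(V0 has_real_derivative d1 V (0, y)) (at y)" for y
    using C_k_Suc_has_real_derivative_along[OF C DERIV_const[of 0] DERIV_ident, of y]
    by (simp add: V_0)
  have d1_0: "d1 V (0, y) = partial 1 V0 y" for y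
    using partial_real_eq[OF dV0] by simp
  have right: "d0 V (s, c + s) - d1 V (s, c + s) = V1 c - partial 1 V0 c" for c s
  proof -
    have "((\<lambda>s. d0 V (s, c + s) - d1 V (s, c + s)) has_real_derivative 0) (at s)" for s
    proof (rule DERIV_cong)
      show "((\<lambda>s. d0 V (s, c + s) - d1 V (s, c + s)) has_real_derivative
          (1 * d0 (d0 V) (s, c + s) + 1 * d1 (d0 V) (s, c + s)) -
          (1 * d0 (d1 V) (s, c + s) + 1 * d1 (d1 V) (s, c + s))) (at s)"
        by (intro DERIV_diff C_k_Suc_has_real_derivative_along[OF C01(1)]
            C_k_Suc_has_real_derivative_along[OF C01(2)]) (auto intro!: derivative_eq_intros)
    qed (simp add: wave mixed_partials_eq[OF \<open>C_k 2 V\<close>])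
    then have "d0 V (s, c + s) - d1 V (s, c + s) = d0 V (0, c + 0) - d1 V (0, c + 0)"
      by (intro DERIV_isconst_all) blast
    then show ?thesis by (simp add: V_0 d1_0)
  qed
  show dal: "V (t, x) = (V0 (x + t) + V0 (x - t)) / 2 + (I (x + t) - I (x - t)) / 2" for t x
  proof -
    \<comment> \<open>Along the line of constant x + t, V changes at the rate V1(c) - V0'(c) with c
      = x + t - 2 s; the other two terms cancel this rate.\<close>
    define E where "E s = V (s, x + t - s) + I (x + t - 2 * s) / 2 - V0 (x + t - 2 * s) / 2" for s
    have "(E has_real_derivative 0) (at s)" for s
    proof (rule DERIV_cong)
      show "(E has_real_derivative (1 * d0 V (s, x + t - s) + (- 1) * d1 V (s, x + t - s)) +
          V1 (x + t - 2 * s) * (- 2) / 2 - d1 V (0, x + t - 2 * s) * (- 2) / 2) (at s)"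
        unfolding E_def
        by (intro DERIV_diff DERIV_add DERIV_cdivide C_k_Suc_has_real_derivative_along[OF C]
            DERIV_chain2[OF I] DERIV_chain2[OF dV0]) (auto intro!: derivative_eq_intros)
      show "(1 * d0 V (s, x + t - s) + (- 1) * d1 V (s, x + t - s)) +
          V1 (x + t - 2 * s) * (- 2) / 2 - d1 V (0, x + t - 2 * s) * (- 2) / 2 = 0"
        using right[of s "x + t - 2 * s"] by (simp add: d1_0)
    qed
    then have "E t = E 0" by (intro DERIV_isconst_all) blast
    then show ?thesis by (simp add: E_def V_0 field_simps)
  qed
  have "((\<lambda>x. V (t, x)) has_real_derivative d1 V (t, x)) (at x)"
    using C_k_Suc_has_real_derivative_along[OF C DERIV_const DERIV_ident] by simp
  moreover have "((\<lambda>x. V (t, x)) has_real_derivative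
      (partial 1 V0 (x + t) * 1 + partial 1 V0 (x - t) * 1) / 2 + (V1 (x + t) * 1 - V1 (x - t) * 1) / 2) (at x)"
    unfolding dal
    by (intro DERIV_add DERIV_diff DERIV_cdivide DERIV_chain2[OF I] DERIV_chain2[OF dV0[unfolded d1_0]])
      (auto intro!: derivative_eq_intros)
  ultimately show "d1 V (t, x) = (partial 1 V0 (x + t) + partial 1 V0 (x - t)) / 2 + (V1 (x + t) - V1 (x - t)) / 2"
    using DERIV_unique by fastforce
qed

section \<open>Compact support and essential supremum\<close>

lemma compact_support_vanishes_outside:
  fixes f :: "real \<Rightarrow> real"
  assumes "compact_support f"
  obtains R where "R > 0" "\<And>x. \<bar>x\<bar> \<ge> R \<Longrightarrow> f x = 0"
proof -
  have "bounded (support_on UNIV f)"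
    using assms bounded_subset[OF compact_imp_bounded closure_subset]
    by (auto simp: compact_support_def)
  then obtain R where R: "\<And>x. f x \<noteq> 0 \<Longrightarrow> \<bar>x\<bar> \<le> R"
    by (auto simp: bounded_iff support_on_def)
  show thesis
    by (rule that[of "\<bar>R\<bar> + 1"]) (use R in force)+
qed

text \<open>For c at or above the essential supremum, the set where |f| exceeds c is open and null,
  hence empty. This turns the smallness hypothesis into a pointwise bound.\<close>

lemma abs_le_esssup:
  fixes f :: "real \<Rightarrow> real"
  assumes "continuous_on UNIV f"
  shows "ereal \<bar>f y\<bar> \<le> esssup lborel (\<lambda>y. ereal \<bar>f y\<bar>)"
proof (rule ccontr)
  assume "\<not> ?thesis"
  then obtain c where c: "esssup lborel (\<lambda>y. ereal \<bar>f y\<bar>) \<le> ereal c" "c < \<bar>f y\<bar>"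
    by (metis ereal_dense2 less_ereal.simps(1) less_imp_le not_le)
  have op: "open {x. c < \<bar>f x\<bar>}"
    by (intro open_Collect_less continuous_intros assms)
  have "AE x in lborel. \<not> c < \<bar>f x\<bar>"
    using esssup_AE[of "\<lambda>y. ereal \<bar>f y\<bar>" lborel]
  proof eventually_elim
    case (elim x)
    then have "ereal \<bar>f x\<bar> \<le> ereal c" using c(1) by (rule order_trans)
    then show ?case by simp
  qed
  then have "{x. c < \<bar>f x\<bar>} \<in> null_sets lborel"
    using op by (subst AE_iff_null_sets) auto
  then have "negligible {x. c < \<bar>f x\<bar>}"
    by (simp add: negligible_iff_null_sets null_sets_completionI)
  with op c(2) show False using open_not_negligible by blast
qed

section \<open>Motion of the particle\<close>

text \<open>This recovers the equations of motion pointwise from their integrated form. The time t =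
  0 is excluded because nothing is known about \<open>F\<close> at negative times.\<close>

lemma has_integral_imp_has_real_derivative:
  fixes f F :: "real \<Rightarrow> real"
  assumes F: "\<And>t. t \<ge> 0 \<Longrightarrow> (f has_integral (F t - F 0)) {0..t}" and t: "t > 0" and f: "isCont f t"
  shows "(F has_real_derivative f t) (at t)"
proof -
  have "((\<lambda>u. integral {0..u} f) has_vector_derivative f t) (at t within {0..t + 1})"
    using integral_has_vector_derivative_continuous_at[of f 0 "t + 1" t "{}"] F[of "t + 1"] f t
    by (auto simp: integrable_on_def intro: continuous_at_imp_continuous_within)
  moreover have "at t within {0..t + 1} = at t"
    by (rule at_within_interior) (use t in auto)
  ultimately have "((\<lambda>u. integral {0..u} f + F 0) has_real_derivative f t) (at t)"
    by (auto simp: has_real_derivative_iff_has_vector_derivative intro!: derivative_eq_intros)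
  moreover have "\<forall>\<^sub>F u in nhds t. integral {0..u} f + F 0 = F u"
    using eventually_nhds_in_open[of "{0<..}" t] t
    by (auto elim!: eventually_mono simp: integral_unique[OF F])
  ultimately show ?thesis by (simp add: DERIV_cong_ev)
qed

text \<open>The integrand may be discontinuous here, so continuity of \<open>p\<close> is available
  before the sign of \<open>m\<close> is known.\<close>

lemma has_integral_imp_continuous_on:
  fixes f F :: "real \<Rightarrow> real"
  assumes F: "\<And>t. t \<ge> 0 \<Longrightarrow> (f has_integral (F t - F 0)) {0..t}"
  shows "continuous_on {0..} F"
proof -
  have "continuous_on {0..T} F" for T
  proof -
    have "continuous_on {0..T} (\<lambda>u. integral {0..u} f + F 0)"
    proof (cases "T \<ge> 0")
      case True
      then show ?thesis
        using F[OF True]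
        by (intro continuous_intros indefinite_integral_continuous_1) (auto simp: integrable_on_def)
    qed simp
    then show ?thesis
      by (rule continuous_on_eq) (simp add: integral_unique[OF F])
  qed
  then have "isCont F t" if "t > 0" for t
    using that continuous_on_interior[of "{0..t + 1}" F t] by auto
  moreover have "continuous (at 0 within {0..}) F"
  proof -
    have "continuous (at 0 within {0..1}) F"
      using \<open>continuous_on {0..1} F\<close> by (simp add: continuous_on_eq_continuous_within)
    moreover have "at 0 within {0..1} = at (0::real) within {0..}"
      by (rule at_within_nhd[of _ "{-1<..<1}"]) auto
    ultimately show ?thesis by simp
  qed
  ultimately show ?thesis
    by (auto simp: continuous_on_eq_continuous_within less_le intro: continuous_at_imp_continuous_within)
qed

text \<open>Since x / 0 = 0, the case m = p = 0 is included; so the world-line is causal before the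
  sign of \<open>m\<close> is known.\<close>

lemma abs_velocity_le_1: "\<bar>p / sqrt (m\<^sup>2 + p\<^sup>2)\<bar> \<le> (1::real)"
proof -
  have "\<bar>p\<bar> \<le> sqrt (m\<^sup>2 + p\<^sup>2)" by (rule real_le_rsqrt) simp
  then show ?thesis by (cases "p = 0") (auto simp: abs_divide divide_le_eq_1 sum_power2_gt_zero_iff)
qed

text \<open>If \<open>z t + t\<close> stayed bounded, the velocity would be close to \<open>-1\<close> on average, so that
  radiation friction pushes \<open>p\<close> up linearly, while the proper-time factor damps the external force:
  \<open>m / E\<close> is at most \<open>sqrt (2 * (z + t)')\<close>, and AM-GM absorbs it.\<close>

lemma world_line_escapes:
  fixes z p m q :: "real \<Rightarrow> real"
  defines "E \<equiv> \<lambda>t. sqrt ((m t)\<^sup>2 + (p t)\<^sup>2)"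
  assumes k: "k > 0" and m: "\<And>t. t > 0 \<Longrightarrow> m t > 0"
    and init: "z 0 = 0" "p 0 = 0"
    and cont: "continuous_on {0..} z" "continuous_on {0..} p"
    and dz: "\<And>t. t > 0 \<Longrightarrow> (z has_real_derivative p t / E t) (at t)"
    and dp: "\<And>t. t > 0 \<Longrightarrow> (p has_real_derivative - k * (p t / E t) + m t / E t * q t) (at t)"
    and q: "\<And>t. t > 0 \<Longrightarrow> \<bar>q t\<bar> \<le> K"
  obtains t where "t \<ge> 0" "z t + t > R"
proof -
  have "\<exists>t\<ge>0. z t + t > R"
  proof (rule ccontr)
    assume "\<not> ?thesis"
    then have R: "z t + t \<le> R" if "t \<ge> 0" for t using that by force
    \<comment> \<open>The part p + k z cancels the friction. The external force is at least - s K
      \<ge> - k / 2 - K^2 / (2 k) s^2, where s = m / E and s^2 \<le> 2 (z + t)'; the last two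
      summands pay for these two losses.\<close>
    define G where "G t = p t + k * z t + k / 2 * t + K\<^sup>2 / k * (z t + t)" for t
    have G_mono: "G 0 \<le> G t" if "t \<ge> 0" for t
    proof (rule DERIV_nonneg_imp_increasing_open[OF that])
      show "continuous_on {0..t} G"
        unfolding G_def by (intro continuous_intros continuous_on_subset[OF cont(1)]
            continuous_on_subset[OF cont(2)]) auto
      fix x :: real assume "0 < x"
      define c s where "c = p x / E x" and "s = m x / E x"
      have "E x > 0" using m[OF \<open>0 < x\<close>] by (simp add: E_def add_pos_nonneg)
      then have "s\<^sup>2 + c\<^sup>2 = 1" "s > 0"
        using m[OF \<open>0 < x\<close>] by (auto simp: s_def c_def power_divide E_def simp flip: add_divide_distrib)
      moreover have "2 * (1 + c) - (1 - c\<^sup>2) = (1 + c)\<^sup>2"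
        by (simp add: power2_eq_square algebra_simps)
      ultimately have s2: "s\<^sup>2 \<le> 2 * (1 + c)"
        using zero_le_power2[of "1 + c"] by linarith
      have "s * q x \<ge> - (s * K)"
        using mult_left_mono[of "- K" "q x" s] q[OF \<open>0 < x\<close>] \<open>s > 0\<close> by (simp add: abs_le_iff)
      moreover have "s * K \<le> k / 2 + K\<^sup>2 / (2 * k) * s\<^sup>2"
      proof -
        have "0 \<le> (k - K * s)\<^sup>2 / (2 * k)" using k by simp
        also have "\<dots> = k / 2 + K\<^sup>2 / (2 * k) * s\<^sup>2 - s * K"
          using k by (simp add: power2_eq_square field_simps)
        finally show ?thesis by simp
      qed
      moreover have "K\<^sup>2 / (2 * k) * s\<^sup>2 \<le> K\<^sup>2 / k * (1 + c)"
      proof -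
        have "K\<^sup>2 / (2 * k) * s\<^sup>2 \<le> K\<^sup>2 / (2 * k) * (2 * (1 + c))"
          by (rule mult_left_mono[OF s2]) (use k in simp)
        also have "\<dots> = K\<^sup>2 / k * (1 + c)" using k by (simp add: field_simps)
        finally show ?thesis .
      qed
      ultimately have "- k * c + s * q x + k * c + k / 2 + K\<^sup>2 / k * (1 + c) \<ge> 0" by linarith
      moreover have "(G has_real_derivative - k * c + s * q x + k * c + k / 2 + K\<^sup>2 / k * (1 + c)) (at x)"
        unfolding G_def c_def s_def
        using k by (auto intro!: derivative_eq_intros dz dp \<open>0 < x\<close>)
      ultimately show "\<exists>y. (G has_real_derivative y) (at x) \<and> y \<ge> 0" by blast
    qed
    have "R \<ge> 0" using R[of 0] init by simp
    \<comment> \<open>From G t \<ge> 0 and z t \<le> R - t follows p t \<ge> k t / 2 - k R - K^2 R /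
      k, and \<open>t1\<close> is the zero of this lower bound.\<close>
    define t1 where "t1 = 2 * R + 2 * K\<^sup>2 / k\<^sup>2 * R"
    have "t1 \<ge> 0" using \<open>R \<ge> 0\<close> by (simp add: t1_def)
    have p_pos: "p t > 0" if "t > t1" for t
    proof -
      have t: "t \<ge> 0" using that \<open>t1 \<ge> 0\<close> by simp
      have "k * z t + k * t \<le> k * R" using R[OF t] k by (simp flip: distrib_left)
      moreover have "K\<^sup>2 / k * (z t + t) \<le> K\<^sup>2 / k * R"
        by (rule mult_left_mono[OF R[OF t]]) (use k in simp)
      moreover have "0 \<le> p t + k * z t + k / 2 * t + K\<^sup>2 / k * (z t + t)"
        using G_mono[OF t] init by (simp add: G_def)
      ultimately have "p t \<ge> k / 2 * t - k * R - K\<^sup>2 / k * R" by linarith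
      moreover have "k / 2 * t > k / 2 * t1" using that k by simp
      moreover have "k / 2 * t1 = k * R + K\<^sup>2 / k * R"
        using k by (simp add: t1_def power2_eq_square field_simps)
      ultimately show ?thesis by linarith
    qed
    \<comment> \<open>After \<open>t1\<close> the particle moves to the right, so z t + t \<ge> z t1
      + t, which exceeds R once t > R - z t1.\<close>
    define t where "t = max t1 (R - z t1) + 1"
    have "z t1 \<le> z t"
    proof (rule DERIV_nonneg_imp_increasing_open[where f = z])
      show "continuous_on {t1..t} z"
        by (rule continuous_on_subset[OF cont(1)]) (use \<open>t1 \<ge> 0\<close> in auto)
      show "\<exists>y. (z has_real_derivative y) (at x) \<and> y \<ge> 0" if "t1 < x" for x
        using dz[of x] p_pos[OF that] that \<open>t1 \<ge> 0\<close>
        by (intro exI[of _ "p x / E x"]) (auto simp: E_def)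
    qed (simp add: t_def)
    moreover have "z t + t \<le> R" by (rule R) (use \<open>t1 \<ge> 0\<close> in \<open>simp add: t_def\<close>)
    ultimately show False by (simp add: t_def max_def split: if_splits)
  qed
  with that show thesis by blast
qed

text \<open>Here (p^2)' = - 2 k p^2 / E, and E \<le> D + k t because |p| does not increase. The
  weight D + k t adds the rate k p^2, at most half of the damping; so the weighted p^2 stays bounded
  while the weight tends to infinity.\<close>

lemma free_momentum_tendsto_0:
  fixes p m :: "real \<Rightarrow> real"
  defines "E \<equiv> \<lambda>t. sqrt ((m t)\<^sup>2 + (p t)\<^sup>2)"
  assumes k: "k > 0" and T: "T \<ge> 0" and m: "\<And>t. t \<ge> T \<Longrightarrow> 0 < m t \<and> m t \<le> C + k * t"
    and dp: "\<And>t. t \<ge> T \<Longrightarrow> (p has_real_derivative - k * (p t / E t)) (at t)"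
  shows "(p \<longlongrightarrow> 0) at_top"
proof -
  have E: "E t > 0" "E t \<le> m t + \<bar>p t\<bar>" if "t \<ge> T" for t
    using m[OF that] sqrt_sum_squares_le_sum_abs[of "m t" "p t"] by (auto simp: E_def add_pos_nonneg)
  have p_bound: "(p t)\<^sup>2 \<le> (p T)\<^sup>2" if "t \<ge> T" for t
  proof (rule DERIV_nonpos_imp_nonincreasing[OF that])
    fix x assume x: "T \<le> x"
    have "((\<lambda>t. (p t)\<^sup>2) has_real_derivative - (2 * k * (p x)\<^sup>2 / E x)) (at x)"
      by (auto intro!: derivative_eq_intros dp[OF x] simp: power2_eq_square)
    moreover have "- (2 * k * (p x)\<^sup>2 / E x) \<le> 0" using k E(1)[OF x] by simp
    ultimately show "\<exists>y. ((\<lambda>t. (p t)\<^sup>2) has_real_derivative y) (at x) \<and> y \<le> 0" by blast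
  qed
  define D where "D = C + \<bar>p T\<bar>"
  have E_le: "E t \<le> D + k * t" if "t \<ge> T" for t
    using E(2)[OF that] m[OF that] p_bound[OF that] by (simp add: D_def abs_le_square_iff[symmetric])
  define H where "H t = (p t)\<^sup>2 * (D + k * t)" for t
  have H: "H t \<le> H T" if "t \<ge> T" for t
  proof (rule DERIV_nonpos_imp_nonincreasing[OF that])
    fix x assume x: "T \<le> x"
    have "(H has_real_derivative 2 * p x * (- k * (p x / E x)) * (D + k * x) + (p x)\<^sup>2 * k) (at x)"
      unfolding H_def by (auto intro!: derivative_eq_intros dp[OF x])
    moreover have "2 * p x * (- k * (p x / E x)) * (D + k * x) + (p x)\<^sup>2 * k \<le> 0"
    proof -
      define r where "r = (D + k * x) / E x"
      have "r \<ge> 1" using E(1)[OF x] E_le[OF x] by (simp add: r_def)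
      then have "k * (p x)\<^sup>2 * (1 - 2 * r) \<le> 0"
        using k by (intro mult_nonneg_nonpos) auto
      moreover have "2 * p x * (- k * (p x / E x)) * (D + k * x) + (p x)\<^sup>2 * k =
          k * (p x)\<^sup>2 * (1 - 2 * r)"
        by (simp add: r_def power2_eq_square algebra_simps)
      ultimately show ?thesis by simp
    qed
    ultimately show "\<exists>y. (H has_real_derivative y) (at x) \<and> y \<le> 0" by blast
  qed
  have "((\<lambda>t. (p t)\<^sup>2) \<longlongrightarrow> 0) at_top"
  proof (rule tendsto_sandwich[of "\<lambda>_. 0"])
    have "\<forall>\<^sub>F t in at_top. t \<ge> T" by (rule eventually_ge_at_top)
    then show "\<forall>\<^sub>F t in at_top. (p t)\<^sup>2 \<le> H T / (D + k * t)"
    proof eventually_elim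
      case (elim t)
      then show ?case using H[OF elim] E_le[OF elim] E(1)[OF elim] by (simp add: H_def pos_le_divide_eq)
    qed
    have "LIM t at_top. D + k * t :> at_top"
      by (intro filterlim_tendsto_add_at_top[OF tendsto_const]
          filterlim_tendsto_pos_mult_at_top[OF tendsto_const k] filterlim_ident)
    then show "((\<lambda>t. H T / (D + k * t)) \<longlongrightarrow> 0) at_top"
      by (intro tendsto_divide_0[OF tendsto_const] filterlim_at_top_imp_at_infinity)
  qed auto
  then show ?thesis by simp
qed

text \<open>Along the world-line the test functions are 1 up to time t, by causality, and 0 after t
  + 1/(n + 1). As \<open>proper_time_rate\<close> is controlled only on (0, T), a globally
  measurable and bounded \<open>\<rho>\<close> replaces it; t < T leaves room for the
  cut-off.\<close>

lemma point_source_tendsto: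
  fixes z \<rho> :: "real \<Rightarrow> real" and \<phi> :: "nat \<Rightarrow> real \<times> real \<Rightarrow> real"
  assumes z: "continuous_on {0..} z"
    and causal: "\<And>s. 0 \<le> s \<Longrightarrow> s \<le> t \<Longrightarrow> s + z s \<le> t + z t \<and> s - z s \<le> t - z t"
    and \<rho>: "\<rho> \<in> borel_measurable borel" "\<And>s. \<bar>\<rho> s\<bar> \<le> 1"
    and rate: "\<And>s. 0 < s \<Longrightarrow> s < T \<Longrightarrow> proper_time_rate z s = \<rho> s"
    and t: "0 \<le> t" "t < T"
    and \<phi>: "\<And>n. continuous_on UNIV (\<phi> n)" "\<And>n x. 0 \<le> \<phi> n x \<and> \<phi> n x \<le> 1"
    and \<phi>_1: "\<And>n s x. s \<ge> 0 \<Longrightarrow> s + x \<le> t + z t \<Longrightarrow> s - x \<le> t - z t \<Longrightarrow> \<phi> n (s, x) = 1"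
    and \<phi>_0: "\<And>n s x. t + z t + 1 / real (Suc n) \<le> s + x \<or> t - z t + 1 / real (Suc n) \<le> s - x \<Longrightarrow>
      \<phi> n (s, x) = 0"
  shows "(\<lambda>n. point_source a z (\<phi> n)) \<longlonglongrightarrow> a * (LINT s:{0..t}|lborel. \<rho> s)"
proof -
  \<comment> \<open>The null coordinates of (s, z s) add up to 2 s, so one of them exceeds that of
    (t, z t) by at least s - t.\<close>
  have \<phi>_0': "\<phi> n (s, z s) = 0" if "t + 1 / real (Suc n) \<le> s" for n s
    by (rule \<phi>_0) (use that in linarith)
  have lim: "(\<lambda>n. 1 / real (Suc n)) \<longlonglongrightarrow> 0" by (rule LIMSEQ_Suc) (rule lim_1_over_n)
  have "\<forall>\<^sub>F n in sequentially. 1 / real (Suc n) < T - t"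
    using order_tendstoD(2)[OF lim] t by simp
  then obtain N where N: "\<And>n. n \<ge> N \<Longrightarrow> 1 / real (Suc n) < T - t"
    by (auto simp: eventually_sequentially)
  define g where "g n s = (indicator {0..} s *\<^sub>R \<phi> n (s, z s)) * \<rho> s" for n s
  define f where "f n s = indicator {0..} s *\<^sub>R (\<phi> n (s, z s) * proper_time_rate z s)" for n s
  have f_eq: "f n s = g n s" if "n \<ge> N" "s \<noteq> 0" for n s
  proof (cases "0 < s \<and> s < T")
    case True
    then show ?thesis by (simp add: f_def g_def rate)
  next
    case False
    have "\<phi> n (s, z s) = 0" if "s \<ge> T"
      by (rule \<phi>_0') (use N[OF \<open>n \<ge> N\<close>] that in linarith)
    then show ?thesis using False that(2) by (auto simp: f_def g_def indicator_def)
  qed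
  have [measurable]: "(\<lambda>s. indicator {0..} s *\<^sub>R \<phi> n (s, z s)) \<in> borel_measurable borel" for n
    by (rule borel_measurable_continuous_on_indicator, simp,
        rule continuous_on_compose2[OF \<phi>(1)], intro continuous_intros z, simp)
  note [measurable] = \<rho>(1)
  have g_meas [measurable]: "g n \<in> borel_measurable borel" for n
    unfolding g_def by measurable
  have f_meas: "f n \<in> borel_measurable borel" if "n \<ge> N" for n
  proof -
    \<comment> \<open>At s = 0, where \<open>deriv\<close> also sees negative times,
      \<open>f n\<close> may differ from \<open>g n\<close>; changing one value preserves
      measurability.\<close>
    have "(\<lambda>s. if s = 0 then f n 0 else g n s) \<in> borel_measurable borel" by measurable
    moreover have "f n = (\<lambda>s. if s = 0 then f n 0 else g n s)"
      using f_eq[OF that] by auto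
    ultimately show ?thesis by metis
  qed
  have eq: "(LINT s|lborel. f n s) = (LINT s|lborel. g n s)" if "n \<ge> N" for n
  proof (rule integral_cong_AE)
    show "AE s in lborel. f n s = g n s"
      using AE_lborel_singleton[of 0] by eventually_elim (simp add: f_eq[OF that])
  qed (use f_meas[OF that] in auto)
  have "(\<lambda>n. LINT s|lborel. g n s) \<longlonglongrightarrow> (LINT s|lborel. indicator {0..t} s *\<^sub>R \<rho> s)"
  proof (rule integral_dominated_convergence[where w = "\<lambda>s. indicator {0..t + 1} s"])
    show "AE s in lborel. norm (g n s) \<le> indicator {0..t + 1} s" for n
    proof (rule AE_I2)
      fix s
      show "norm (g n s) \<le> indicator {0..t + 1} s"
      proof (cases "s \<in> {0..t + 1}")
        case True
        then show ?thesis
          using \<phi>(2)[of n "(s, z s)"] \<rho>(2)[of s] by (simp add: g_def abs_mult mult_le_one)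
      next
        case False
        have "1 / real (Suc n) \<le> 1" by simp
        then have "\<phi> n (s, z s) = 0" if "s > t + 1" by (intro \<phi>_0') (use that in linarith)
        with False show ?thesis by (auto simp: g_def indicator_def)
      qed
    qed
    show "AE s in lborel. (\<lambda>n. g n s) \<longlonglongrightarrow> indicator {0..t} s *\<^sub>R \<rho> s"
    proof (rule AE_I2)
      fix s
      consider "s < 0" | "0 \<le> s" "s \<le> t" | "s > t" by linarith
      then show "(\<lambda>n. g n s) \<longlonglongrightarrow> indicator {0..t} s *\<^sub>R \<rho> s"
      proof cases
        case 1
        then show ?thesis by (simp add: g_def)
      next
        case 2
        then have "\<phi> n (s, z s) = 1" for n using causal[of s] by (intro \<phi>_1) auto
        with 2 show ?thesis by (simp add: g_def)
      next
        case 3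
        then have "\<forall>\<^sub>F n in sequentially. 1 / real (Suc n) < s - t"
          using order_tendstoD(2)[OF lim] by simp
        then have "\<forall>\<^sub>F n in sequentially. g n s = 0"
          by eventually_elim (simp add: g_def \<phi>_0')
        then show ?thesis using 3 by (simp add: tendsto_eventually)
      qed
    qed
  qed (auto intro!: integrable_real_indicator simp: emeasure_lborel_Icc_eq)
  moreover have "\<forall>\<^sub>F n in sequentially. (LINT s|lborel. g n s) = (LINT s|lborel. f n s)"
    using eventually_ge_at_top[of N] by eventually_elim (simp add: eq)
  ultimately have "(\<lambda>n. LINT s|lborel. f n s) \<longlonglongrightarrow> (LINT s|lborel. indicator {0..t} s *\<^sub>R \<rho> s)"
    by (rule Lim_transform_eventually)
  then show ?thesis
    unfolding point_source_def set_lebesgue_integral_def f_def by (rule tendsto_mult_left)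
qed

section \<open>Bounds on the free wave\<close>

lemma bounded_of_vanishing_outside:
  fixes f :: "real \<Rightarrow> real"
  assumes "continuous_on UNIV f" and "\<And>x. \<bar>x\<bar> \<ge> R \<Longrightarrow> f x = 0"
  obtains B where "\<And>x. \<bar>f x\<bar> \<le> B"
proof -
  have "bounded (f ` {- \<bar>R\<bar>..\<bar>R\<bar>})"
    by (intro compact_imp_bounded compact_continuous_image continuous_on_subset[OF assms(1)]) auto
  then obtain B where B: "\<forall>y\<in>f ` {- \<bar>R\<bar>..\<bar>R\<bar>}. norm y \<le> B" by (auto simp: bounded_iff)
  have "\<bar>f x\<bar> \<le> \<bar>B\<bar>" for x
  proof (cases "x \<in> {- \<bar>R\<bar>..\<bar>R\<bar>}")
    case True
    then have "norm (f x) \<le> B" using B by blast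
    then show ?thesis by simp
  next
    case False
    then have "f x = 0" by (intro assms(2)) auto
    then show ?thesis by simp
  qed
  with that show thesis by blast
qed

lemma integrable_of_vanishing_outside:
  fixes f :: "real \<Rightarrow> real"
  assumes "continuous_on UNIV f" and "\<And>x. \<bar>x\<bar> \<ge> R \<Longrightarrow> f x = 0"
  shows "integrable lborel f"
proof -
  have "integrable lborel (\<lambda>x. indicator {- R..R} x *\<^sub>R f x)"
    by (intro borel_integrable_compact continuous_on_subset[OF assms(1)]) auto
  moreover have "(\<lambda>x. indicator {- R..R} x *\<^sub>R f x) = f"
    by (rule ext, rename_tac x, case_tac "\<bar>x\<bar> \<ge> R") (auto simp: assms(2) indicator_def)
  ultimately show ?thesis by metis
qed

lemma partial_vanishing_outside:
  fixes f :: "real \<Rightarrow> real"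
  assumes "\<And>x. \<bar>x\<bar> \<ge> R \<Longrightarrow> f x = 0" and "\<bar>x\<bar> > R"
  shows "partial 1 f x = 0"
proof (rule partial_real_eq)
  have "open {y::real. R < \<bar>y\<bar>}" by (intro open_Collect_less continuous_intros)
  then have "\<forall>\<^sub>F y in nhds x. y \<in> {y. R < \<bar>y\<bar>}"
    by (rule eventually_nhds_in_open) (use assms(2) in simp)
  then have "\<forall>\<^sub>F y in nhds x. f y = 0"
    by eventually_elim (simp add: assms(1))
  then show "(f has_real_derivative 0) (at x)"
    by (subst DERIV_cong_ev[OF refl _ refl]) auto
qed

lemma has_integral_bounded_imp_lipschitz:
  fixes f F :: "real \<Rightarrow> real"
  assumes F: "\<And>t. t \<ge> 0 \<Longrightarrow> (f has_integral (F t - F 0)) {0..t}" and f: "\<And>s. \<bar>f s\<bar> \<le> B"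
    and st: "0 \<le> s" "s \<le> t"
  shows "\<bar>F t - F s\<bar> \<le> B * (t - s)"
proof -
  have t: "0 \<le> t" using st by simp
  have int: "f integrable_on {0..t}" using F[OF t] by (auto simp: integrable_on_def)
  have "integral {0..s} f + integral {s..t} f = integral {0..t} f"
    by (rule Henstock_Kurzweil_Integration.integral_combine[OF st int])
  then have eq: "integral {s..t} f = F t - F s"
    using integral_unique[OF F[OF t]] integral_unique[OF F[OF st(1)]] by simp
  have "f integrable_on {s..t}" by (rule integrable_subinterval_real[OF int]) (use st in auto)
  then have "(f has_integral (F t - F s)) (cbox s t)"
    using eq by (simp add: has_integral_integral)
  moreover have "B \<ge> 0" using f[of 0] by simp
  ultimately have "norm (F t - F s) \<le> B * measure lborel (cbox s t)"
    using f by (intro has_integral_bound) auto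
  then show ?thesis using st by simp
qed

text \<open>All bounds come from d'Alembert's formula. Between the two outgoing waves V itself need
  not vanish, being half the integral of \<open>V1\<close>; only its space derivative does, and this
  is the force.\<close>

lemma free_wave_solution_bounds:
  assumes V: "free_wave_solution V0 V1 V"
    and V0: "smooth V0" "compact_support V0" and V1: "smooth V1" "compact_support V1"
    and small: "esssup lborel (\<lambda>y. ereal \<bar>V0 y\<bar>) + ereal (1 / 2 * (LINT y|lborel. \<bar>V1 y\<bar>)) < ereal b"
  obtains M K R where "M < b" "\<And>t x. t \<ge> 0 \<Longrightarrow> \<bar>V (t, x)\<bar> \<le> M" "\<And>t x. \<bar>d1 V (t, x)\<bar> \<le> K"
    "\<And>t x. x + t > R \<Longrightarrow> t - x > R \<Longrightarrow> d1 V (t, x) = 0"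
    "integrable lborel V1" "\<And>t x. t \<ge> 0 \<Longrightarrow>
      V (t, x) = (V0 (x + t) + V0 (x - t) + (LINT y:{x - t..x + t}|lborel. V1 y)) / 2"
proof -
  obtain R0 where R0: "R0 > 0" "\<And>x. \<bar>x\<bar> \<ge> R0 \<Longrightarrow> V0 x = 0"
    using compact_support_vanishes_outside[OF V0(2)] by blast
  obtain R1 where R1: "R1 > 0" "\<And>x. \<bar>x\<bar> \<ge> R1 \<Longrightarrow> V1 x = 0"
    using compact_support_vanishes_outside[OF V1(2)] by blast
  \<comment> \<open>The added 1 gives the strict inequality under which the derivative of
    \<open>V0\<close> vanishes too.\<close>
  define R where "R = max R0 R1 + 1"
  have C_k: "C_k 0 V0" "C_k (Suc 0) V0" "C_k 0 V1" using V0 V1 unfolding smooth_def by blast+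
  then have cont: "continuous_on UNIV V0" "continuous_on UNIV (partial 1 V0)" "continuous_on UNIV V1"
    by auto
  have zero: "V1 x = 0" "partial 1 V0 x = 0" if "\<bar>x\<bar> \<ge> R" for x
    using that R1(2)[of x] partial_vanishing_outside[of R0 V0 x] R0(2) by (auto simp: R_def)
  obtain B0 where B0: "\<And>x. \<bar>partial 1 V0 x\<bar> \<le> B0"
    using bounded_of_vanishing_outside[OF cont(2) zero(2)] by blast
  obtain B1 where B1: "\<And>x. \<bar>V1 x\<bar> \<le> B1"
    using bounded_of_vanishing_outside[OF cont(3) zero(1)] by blast
  have intV1: "integrable lborel V1"
    by (rule integrable_of_vanishing_outside[OF cont(3) zero(1)])
  define I where "I x = integral {- R - 1..x} V1" for x
  have I: "(I has_real_derivative V1 x) (at x)" for x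
    unfolding I_def by (rule antiderivative_of_vanishing_left[OF cont(3)]) (rule zero, simp)
  note dal = free_wave_solution_dalembert[OF V I] and d1 = free_wave_solution_d1[OF V I]
  have I_diff: "(LINT y:{x - t..x + t}|lborel. V1 y) = I (x + t) - I (x - t)" if "t \<ge> 0" for t x
    using integral_FTC_Icc_real[of "x - t" "x + t" I V1] that I cont(3)
    by (simp add: set_lebesgue_integral_def mult.commute continuous_on_eq_continuous_at)
  have I_bound: "\<bar>LINT y:S|lborel. V1 y\<bar> \<le> (LINT y|lborel. \<bar>V1 y\<bar>)" if "S \<in> sets borel" for S
  proof -
    have "norm (LINT y|lborel. indicator S y *\<^sub>R V1 y) \<le> (LINT y|lborel. \<bar>V1 y\<bar>)"
      by (rule Bochner_Integration.integral_norm_bound_integral)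
        (use integrable_mult_indicator[of S lborel V1] intV1 that in
          \<open>auto split: split_indicator\<close>)
    then show ?thesis by (simp add: set_lebesgue_integral_def)
  qed
  have le: "ereal \<bar>V0 y\<bar> \<le> esssup lborel (\<lambda>y. ereal \<bar>V0 y\<bar>)" for y
    by (rule abs_le_esssup[OF cont(1)])
  \<comment> \<open>The hypothesis \<open>small\<close> excludes \<infinity>, and the pointwise
    bound \<open>le\<close> excludes - \<infinity>.\<close>
  obtain M0 where M0: "esssup lborel (\<lambda>y. ereal \<bar>V0 y\<bar>) = ereal M0"
    using small le[of 0] by (cases "esssup lborel (\<lambda>y. ereal \<bar>V0 y\<bar>)") auto
  have V0_le: "\<bar>V0 y\<bar> \<le> M0" for y using le[of y] by (simp add: M0)
  show thesis
  proof (rule that[of "M0 + (LINT y|lborel. \<bar>V1 y\<bar>) / 2" "B0 + B1" R])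
    show "M0 + (LINT y|lborel. \<bar>V1 y\<bar>) / 2 < b" using small by (simp add: M0)
    show V_eq: "V (t, x) = (V0 (x + t) + V0 (x - t) + (LINT y:{x - t..x + t}|lborel. V1 y)) / 2"
      if "t \<ge> 0" for t x
      unfolding I_diff[OF that] dal by (simp add: field_simps)
    show "\<bar>V (t, x)\<bar> \<le> M0 + (LINT y|lborel. \<bar>V1 y\<bar>) / 2" if "t \<ge> 0" for t x
      unfolding V_eq[OF that]
      using V0_le[of "x + t"] V0_le[of "x - t"] I_bound[of "{x - t..x + t}"] by simp
    show "\<bar>d1 V (t, x)\<bar> \<le> B0 + B1" for t x
      unfolding d1 abs_le_iff
      using abs_le_D1[OF B0[of "x + t"]] abs_le_D1[OF B0[of "x - t"]] abs_le_D1[OF B1[of "x + t"]]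
        abs_le_D1[OF B1[of "x - t"]] abs_le_D2[OF B0[of "x + t"]] abs_le_D2[OF B0[of "x - t"]]
        abs_le_D2[OF B1[of "x + t"]] abs_le_D2[OF B1[of "x - t"]]
      by (intro conjI; simp add: field_simps)
    show "d1 V (t, x) = 0" if "x + t > R" "t - x > R" for t x
      unfolding d1 using zero[of "x + t"] zero[of "x - t"] that by simp
  qed (rule intV1)
qed

section \<open>Positivity of the mass and decay of the velocity\<close>

theorem theorem4p1:
  fixes mt a :: real
    and V0 V1 :: "real \<Rightarrow> real"
    and V U :: "real \<times> real \<Rightarrow> real"
    and z p :: "real \<Rightarrow> real"
  assumes "mt > 0" and "a \<noteq> 0"
    and "smooth V0" and "compact_support V0"
    and "smooth V1" and "compact_support V1"
    and "esssup lborel (\<lambda>y. ereal \<bar>V0 y\<bar>) + ereal (1 / 2 * (LINT y|lborel. \<bar>V1 y\<bar>))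
           < ereal (mt / \<bar>a\<bar>)"
    and "free_wave_solution V0 V1 V"
    and "\<exists>L. L-lipschitz_on ({0..} \<times> UNIV) U"
    and "\<exists>L. L-lipschitz_on {0..} z"
    and "distributional_wave_solution (point_source a z)
           (\<lambda>y. - (a / 2) * \<bar>y\<bar> + V0 y) V1 U"
    and "equations_of_motion a V (dynamical_mass mt a U z) z p"
  shows "(\<forall>t>0. proper_velocity z t = p t / dynamical_mass mt a U z t) \<and>
         (\<forall>\<epsilon>>0. \<exists>T>0. \<forall>t>T. \<bar>proper_velocity z t\<bar> < \<epsilon>)"
proof -
  define m where "m = dynamical_mass mt a U z"
  define E where "E t = sqrt ((m t)\<^sup>2 + (p t)\<^sup>2)" for t
  define k where "k = a\<^sup>2 / 2"
  have k: "k > 0" using \<open>a \<noteq> 0\<close> by (simp add: k_def)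
  define U0 where "U0 y = - (a / 2) * \<bar>y\<bar> + V0 y" for y
  have dws: "distributional_wave_solution (point_source a z) U0 V1 U"
    using assms(11) by (simp add: U0_def[abs_def])
  have cont_U: "continuous_on ({0..} \<times> UNIV) U" and cont_z: "continuous_on {0..} z"
    using assms(9,10) lipschitz_on_continuous_on by blast+
  have init: "z 0 = 0" "p 0 = 0"
    and z_int: "\<And>t. t \<ge> 0 \<Longrightarrow> ((\<lambda>s. p s / E s) has_integral (z t - z 0)) {0..t}"
    and p_int: "\<And>t. t \<ge> 0 \<Longrightarrow>
      ((\<lambda>s. - k * (p s / E s) + a * (m s / E s) * d1 V (s, z s)) has_integral (p t - p 0)) {0..t}"
    using assms(12) by (auto simp: equations_of_motion_def m_def E_def k_def)
  have cont_p: "continuous_on {0..} p" by (rule has_integral_imp_continuous_on[OF p_int])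
  have cont_m: "continuous_on {0..} m"
    unfolding m_def dynamical_mass_def
    by (intro continuous_intros continuous_on_compose2[OF cont_U] cont_z) auto
  have isCont_pos: "isCont f t" if "continuous_on {0..} f" "t > 0" for f :: "real \<Rightarrow> real" and t
    using continuous_on_interior[OF that(1), of t] that(2) by simp
  have causal: "\<bar>z t - z s\<bar> \<le> t - s" if "0 \<le> s" "s \<le> t" for s t
    using has_integral_bounded_imp_lipschitz[OF z_int, of 1 s t] abs_velocity_le_1 that
    by (simp add: E_def)
  \<comment> \<open>Positivity of \<open>m t\<close> keeps \<open>E\<close> away from 0, so that the
    velocity is continuous at t, and removes the absolute value from sqrt (1 - v^2) = |m| /
    E.\<close>
  have dz: "(z has_real_derivative p t / E t) (at t)"
    and rate: "proper_time_rate z t = m t / E t"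
    and velocity: "proper_velocity z t = p t / m t" if "t > 0" "m t > 0" for t
  proof -
    have E: "E t > 0" using that by (simp add: E_def add_pos_nonneg)
    have "isCont (\<lambda>s. p s / E s) t"
      unfolding E_def using E
      by (intro continuous_intros isCont_pos[OF cont_p] isCont_pos[OF cont_m] that) (use that in simp)
    from has_integral_imp_has_real_derivative[OF z_int that(1) this]
    show dz: "(z has_real_derivative p t / E t) (at t)" .
    have "1 - (p t / E t)\<^sup>2 = ((E t)\<^sup>2 - (p t)\<^sup>2) / (E t)\<^sup>2"
      using E by (simp add: power_divide diff_divide_distrib)
    also have "(E t)\<^sup>2 - (p t)\<^sup>2 = (m t)\<^sup>2" by (simp add: E_def)
    finally have "1 - (p t / E t)\<^sup>2 = (m t / E t)\<^sup>2" by (simp add: power_divide)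
    then show rate: "proper_time_rate z t = m t / E t"
      using E that by (simp add: proper_time_rate_def DERIV_imp_deriv[OF dz])
    show "proper_velocity z t = p t / m t"
      using E that by (simp add: proper_velocity_def rate DERIV_imp_deriv[OF dz])
  qed
  obtain M K R where M: "M < mt / \<bar>a\<bar>" and V_le: "\<And>t x. t \<ge> 0 \<Longrightarrow> \<bar>V (t, x)\<bar> \<le> M"
    and d1_le: "\<And>t x. \<bar>d1 V (t, x)\<bar> \<le> K"
    and d1_0: "\<And>t x. x + t > R \<Longrightarrow> t - x > R \<Longrightarrow> d1 V (t, x) = 0"
    and intV1: "integrable lborel V1"
    and V_eq: "\<And>t x. t \<ge> 0 \<Longrightarrow>
      V (t, x) = (V0 (x + t) + V0 (x - t) + (LINT y:{x - t..x + t}|lborel. V1 y)) / 2"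
    using free_wave_solution_bounds[OF assms(8,3-7)] by metis
  define \<delta> where "\<delta> = mt - \<bar>a\<bar> * M"
  have \<delta>: "\<delta> > 0" using M \<open>a \<noteq> 0\<close> by (simp add: \<delta>_def field_simps)
  have aV: "\<bar>a * V (t, x)\<bar> \<le> \<bar>a\<bar> * M" if "t \<ge> 0" for t x
    using V_le[OF that] by (simp add: abs_mult mult_left_mono)
  \<comment> \<open>Freezing the argument at 0 for negative times gives a measurable function on the
    whole line, whatever the sign of \<open>m\<close>.\<close>
  define \<rho> where "\<rho> s = m (max 0 s) / sqrt ((m (max 0 s))\<^sup>2 + (p (max 0 s))\<^sup>2)" for s
  have cont_max: "continuous_on UNIV (\<lambda>s. f (max 0 s))" if "continuous_on {0..} f" for f :: "real \<Rightarrow> real"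
    by (rule continuous_on_compose2[OF that]) (auto intro!: continuous_intros)
  have \<rho>_meas [measurable]: "\<rho> \<in> borel_measurable borel"
    unfolding \<rho>_def
    using borel_measurable_continuous_onI[OF cont_max[OF cont_m]]
      borel_measurable_continuous_onI[OF cont_max[OF cont_p]] by measurable
  have \<rho>_le: "\<bar>\<rho> s\<bar> \<le> 1" for s
    using abs_velocity_le_1[of "m (max 0 s)" "p (max 0 s)"] by (simp add: \<rho>_def add.commute)
  have \<rho>_eq: "\<rho> s = m s / E s" if "s \<ge> 0" for s using that by (simp add: \<rho>_def E_def)
  have ind: "integrable lborel (indicator {0..t} :: real \<Rightarrow> real)" for t :: real
    by (rule integrable_real_indicator) (auto simp: emeasure_lborel_Icc_eq)
  have \<rho>_integrable: "integrable lborel (\<lambda>s. indicator {0..t} s *\<^sub>R \<rho> s)" for t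
    by (rule Bochner_Integration.integrable_bound[OF ind[of t]])
      (use \<rho>_le in \<open>auto simp: indicator_def\<close>)
  have \<rho>_int_le: "(LINT s:{0..t}|lborel. \<rho> s) \<le> t" if "t \<ge> 0" for t
  proof -
    have "(LINT s:{0..t}|lborel. \<rho> s) \<le> (LINT s|lborel. indicator {0..t} s)"
      unfolding set_lebesgue_integral_def
      by (rule Bochner_Integration.integral_mono[OF \<rho>_integrable ind])
        (use \<rho>_le in \<open>auto simp: indicator_def abs_le_iff\<close>)
    then show ?thesis using that by simp
  qed
  \<comment> \<open>Positivity is required up to some T > t because the test functions reach
    slightly beyond time t, and the proper-time rate is identified with \<open>m / E\<close> only
    where \<open>m\<close> is positive.\<close>
  have m_eq: "m t = mt - a * V (t, z t) + k * (t - (LINT s:{0..t}|lborel. \<rho> s))"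
    if t: "0 \<le> t" "t < T" and pos: "\<And>s. 0 < s \<Longrightarrow> s < T \<Longrightarrow> m s > 0" for t T
  proof -
    define Ue where "Ue x = U (max 0 (fst x), snd x)" for x
    have cont_Ue: "continuous_on UNIV Ue"
      unfolding Ue_def by (rule continuous_on_compose2[OF cont_U]) (auto intro!: continuous_intros)
    have Ue: "Ue (t, x) = U (t, x)" if "t \<ge> 0" for t x using that by (simp add: Ue_def)
    have cont_U0: "continuous_on UNIV U0"
      using \<open>smooth V0\<close> C_k.simps(1)[of V0] unfolding U0_def smooth_def
      by (intro continuous_intros) blast
    obtain \<phi> where \<phi>: "\<And>n. continuous_on UNIV (\<phi> n)" "\<And>n x. 0 \<le> \<phi> n x \<and> \<phi> n x \<le> 1"
      and \<phi>_1: "\<And>n s x. s \<ge> 0 \<Longrightarrow> s + x \<le> t + z t \<Longrightarrow> s - x \<le> t - z t \<Longrightarrow> \<phi> n (s, x) = 1"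
      and \<phi>_0: "\<And>n s x. t + z t + 1 / real (Suc n) \<le> s + x \<or> t - z t + 1 / real (Suc n) \<le> s - x \<Longrightarrow>
        \<phi> n (s, x) = 0"
      and lim: "(\<lambda>n. point_source a z (\<phi> n)) \<longlonglongrightarrow>
        2 * U (t, z t) - U0 (z t + t) - U0 (z t - t) - (LINT y:{z t - t..z t + t}|lborel. V1 y)"
      using dalembert_test_functions[OF dws cont_Ue Ue cont_U0 intV1 t(1), of "z t"] by metis
    have "(\<lambda>n. point_source a z (\<phi> n)) \<longlonglongrightarrow> a * (LINT s:{0..t}|lborel. \<rho> s)"
    proof (rule point_source_tendsto[OF cont_z _ \<rho>_meas \<rho>_le _ t \<phi> \<phi>_1 \<phi>_0])
      show "s + z s \<le> t + z t \<and> s - z s \<le> t - z t" if "0 \<le> s" "s \<le> t" for s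
        using causal[OF that] by linarith
      show "proper_time_rate z s = \<rho> s" if "0 < s" "s < T" for s
        using rate[OF that(1) pos[OF that]] \<rho>_eq[of s] that by simp
    qed
    from LIMSEQ_unique[OF lim this]
    have "2 * U (t, z t) = U0 (z t + t) + U0 (z t - t) + (LINT y:{z t - t..z t + t}|lborel. V1 y) +
        a * (LINT s:{0..t}|lborel. \<rho> s)" by simp
    \<comment> \<open>Hence |z + t| + |z - t| = 2 t, and the static data contribute exactly - a t to
      2 U, wherever the particle is.\<close>
    moreover have "\<bar>z t\<bar> \<le> t" using causal[of 0 t] t init by simp
    ultimately have U_eq: "U (t, z t) = V (t, z t) - a / 2 * t + a / 2 * (LINT s:{0..t}|lborel. \<rho> s)"
      using V_eq[OF t(1), of "z t"] by (simp add: U0_def field_simps)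
    show ?thesis
      unfolding m_def dynamical_mass_def U_eq by (simp add: k_def power2_eq_square field_simps)
  qed
  have m_ge: "m t \<ge> \<delta>" if "0 \<le> t" "t < T" "\<And>s. 0 < s \<Longrightarrow> s < T \<Longrightarrow> m s > 0" for t T
  proof -
    have "k * (t - (LINT s:{0..t}|lborel. \<rho> s)) \<ge> 0"
      using \<rho>_int_le[OF that(1)] k by simp
    then show ?thesis
      using m_eq[OF that] aV[OF that(1), of "z t"] by (simp add: \<delta>_def)
  qed
  have m_pos: "m t > 0" if "t \<ge> 0" for t
  proof (rule ccontr)
    assume "\<not> m t > 0"
    \<comment> \<open>By continuity there is a first time \<open>T\<close> at which \<open>m\<close>
      is not positive. Before it \<open>m_ge\<close> applies with this very \<open>T\<close>, and
      the bound \<delta> passes to the limit from the left.\<close>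
    define A where "A = {0..} \<inter> m -` {..0}"
    have A: "A \<noteq> {}" "bdd_below A" "closed A"
      using that \<open>\<not> m t > 0\<close> continuous_closed_preimage[OF cont_m, of "{..0}"] by (auto simp: A_def)
    define T where "T = Inf A"
    have "T \<in> A" unfolding T_def by (rule closed_contains_Inf[OF A])
    then have T: "T \<ge> 0" "m T \<le> 0" by (auto simp: A_def)
    have pos: "m s > 0" if "0 \<le> s" "s < T" for s
      using cInf_lower[OF _ A(2), of s] that by (force simp: A_def T_def)
    \<comment> \<open>The static data vanish at the initial position of the particle, so
      \<open>m\<close> starts positive and \<open>T\<close> is not 0.\<close>
    have "U (0, 0) = V0 0" "V (0, 0) = V0 0"
      using dws assms(8)
      by (auto simp: distributional_wave_solution_def free_wave_solution_def U0_def)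
    then have "m 0 = mt - a * V (0, 0)" by (simp add: m_def dynamical_mass_def init)
    then have "m 0 > 0" using aV[of 0 0] \<delta> by (simp add: \<delta>_def)
    then have "T > 0" using T by (cases "T = 0") auto
    have "(m \<longlongrightarrow> m T) (at_left T)"
      using isCont_pos[OF cont_m \<open>T > 0\<close>] by (simp add: isCont_def filterlim_at_split)
    moreover have "\<forall>\<^sub>F s in at_left T. m s \<ge> \<delta>"
      using eventually_at_left_real[OF \<open>T > 0\<close>]
      by eventually_elim (rule m_ge[where T = T], use pos in auto)
    ultimately have "m T \<ge> \<delta>" by (rule tendsto_lowerbound) simp
    with T \<delta> show False by simp
  qed
  have m_bounds: "\<delta> \<le> m t" "m t \<le> mt + \<bar>a\<bar> * M + k * t" if "t \<ge> 0" for t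
  proof -
    show "\<delta> \<le> m t" by (rule m_ge[of t "t + 1"]) (use that m_pos in auto)
    have "0 \<le> indicator {0..t} s *\<^sub>R \<rho> s" for s
      using m_pos[of s] by (auto simp: \<rho>_eq E_def indicator_def)
    then have "(LINT s:{0..t}|lborel. \<rho> s) \<ge> 0"
      unfolding set_lebesgue_integral_def by (intro Bochner_Integration.integral_nonneg)
    then have "k * (t - (LINT s:{0..t}|lborel. \<rho> s)) \<le> k * t" using k by simp
    moreover have "m t = mt - a * V (t, z t) + k * (t - (LINT s:{0..t}|lborel. \<rho> s))"
      by (rule m_eq[of t "t + 1"]) (use that m_pos in auto)
    ultimately show "m t \<le> mt + \<bar>a\<bar> * M + k * t"
      using aV[OF that, of "z t"] by linarith
  qed
  have dz: "(z has_real_derivative p t / E t) (at t)" if "t > 0" for t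
    by (rule dz) (use that m_pos in auto)
  define q where "q t = a * d1 V (t, z t)" for t
  have dp: "(p has_real_derivative - k * (p t / E t) + m t / E t * q t) (at t)" if "t > 0" for t
  proof -
    have "C_k (Suc (Suc 0)) V" using assms(8) by (simp add: free_wave_solution_def numeral_2_eq_2)
    then have "C_k (Suc 0) (d1 V)" by (auto simp: Basis_prod_def)
    from C_k_SucD[OF this] have "continuous_on UNIV (d1 V)" by simp
    then have "continuous_on {0..} (\<lambda>s. d1 V (s, z s))"
      by (rule continuous_on_compose2) (auto intro!: continuous_intros cont_z)
    moreover have "E t \<noteq> 0" using m_pos[of t] that by (simp add: E_def)
    ultimately have "isCont (\<lambda>s. - k * (p s / E s) + a * (m s / E s) * d1 V (s, z s)) t"
      unfolding E_def
      by (intro continuous_intros isCont_pos[OF cont_p] isCont_pos[OF cont_m] that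
          isCont_pos[of "\<lambda>s. d1 V (s, z s)"]) (simp_all add: E_def)
    from has_integral_imp_has_real_derivative[OF p_int that this]
    show ?thesis by (rule DERIV_cong) (simp_all add: q_def)
  qed
  have q_le: "\<bar>q t\<bar> \<le> \<bar>a\<bar> * K" for t
    using d1_le[of t "z t"] by (simp add: q_def abs_mult mult_left_mono)
  obtain t1 where t1: "t1 \<ge> 0" "z t1 + t1 > R"
    by (rule world_line_escapes[of k m z p q "\<bar>a\<bar> * K" R])
      (use k m_pos init cont_z cont_p dz dp q_le in \<open>auto simp: E_def\<close>)
  \<comment> \<open>The reflection of space sends (z, p, q) to (- z, - p, - q) and keeps
    \<open>m\<close>; so the other null coordinate escapes as well.\<close>
  obtain t2 where t2: "t2 \<ge> 0" "- z t2 + t2 > R"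
  proof (rule world_line_escapes[of k m "\<lambda>t. - z t" "\<lambda>t. - p t" "\<lambda>t. - q t" "\<bar>a\<bar> * K" R])
    fix t :: real assume t: "t > 0"
    show "((\<lambda>t. - z t) has_real_derivative - p t / sqrt ((m t)\<^sup>2 + (- p t)\<^sup>2)) (at t)"
      using DERIV_minus[OF dz[OF t]] by (simp add: E_def)
    show "((\<lambda>t. - p t) has_real_derivative - k * (- p t / sqrt ((m t)\<^sup>2 + (- p t)\<^sup>2)) +
        m t / sqrt ((m t)\<^sup>2 + (- p t)\<^sup>2) * - q t) (at t)"
      using DERIV_minus[OF dp[OF t]] by (simp add: E_def)
  qed (use k m_pos init cont_z cont_p q_le in \<open>auto intro!: continuous_intros\<close>)
  \<comment> \<open>The 1 keeps \<open>T0\<close> positive, as the differential equations are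
    available for t > 0. By causality both null coordinates stay above R from \<open>T0\<close>
    on.\<close>
  define T0 where "T0 = max 1 (max t1 t2)"
  have q_0: "q t = 0" if "t \<ge> T0" for t
  proof -
    have "z t + t > R" "t - z t > R"
      using causal[of t1 t] causal[of t2 t] t1 t2 that by (auto simp: T0_def)
    then show ?thesis by (simp add: q_def d1_0)
  qed
  have "(p \<longlongrightarrow> 0) at_top"
  proof (rule free_momentum_tendsto_0[OF k])
    show "T0 \<ge> 0" by (simp add: T0_def)
    show "0 < m t \<and> m t \<le> mt + \<bar>a\<bar> * M + k * t" if "t \<ge> T0" for t
      using m_bounds[of t] m_pos[of t] that by (simp add: T0_def)
    show "(p has_real_derivative - k * (p t / sqrt ((m t)\<^sup>2 + (p t)\<^sup>2))) (at t)" if "t \<ge> T0" for t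
      using dp[of t] q_0[OF that] that by (simp add: E_def T0_def)
  qed
  then have p_small: "\<forall>\<^sub>F t in at_top. \<bar>p t\<bar> < e" if "e > 0" for e
    using tendstoD[OF _ that] by fastforce
  have vel: "proper_velocity z t = p t / m t" if "t > 0" for t
    by (rule velocity) (use that m_pos in auto)
  have "\<exists>T>0. \<forall>t>T. \<bar>proper_velocity z t\<bar> < \<epsilon>" if \<epsilon>: "\<epsilon> > 0" for \<epsilon>
  proof -
    obtain T where T: "\<And>t. t \<ge> T \<Longrightarrow> \<bar>p t\<bar> < \<epsilon> * \<delta>"
      using p_small[of "\<epsilon> * \<delta>"] \<epsilon> \<delta> by (auto simp: eventually_at_top_linorder)
    have "\<bar>proper_velocity z t\<bar> < \<epsilon>" if t: "t > max T 1" for t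
    proof -
      have "\<bar>p t\<bar> < \<epsilon> * \<delta>" by (rule T) (use t in simp)
      also have "\<dots> \<le> \<epsilon> * m t" using m_bounds(1)[of t] t \<epsilon> by simp
      finally show ?thesis using t m_pos[of t] by (simp add: vel abs_divide pos_divide_less_eq)
    qed
    then show ?thesis by (intro exI[of _ "max T 1"]) auto
  qed
  with vel show ?thesis by (auto simp: m_def)
qed

end
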